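(* Consider the two-star model $\mathbb{P}_n$ on graphs with $n$ vertices, with parameters $(\theta,\beta)\in(0,\infty)\times\mathbb{R}$. (a) (Both parameters unknown.) There exist estimators $\hat\theta=\hat\theta_n:\mathcal{G}_n\to\mathbb{R}$ and $\hat\beta=\hat\beta_n:\mathcal{G}_n\to\mathbb{R}$, not depending on $(\theta,\beta)$, such that for every $(\theta,\beta)\in(0,\infty)\times\mathbb{R}$, when $G$ is drawn from $\mathbb{P}_n$ with parameters $(\theta,\beta)$, $\sqrt{n}\,(\hat\theta_n(G)-\theta,\hat\beta_n(G)-\beta)=O_P(1)$ as $n\to\infty$. (b) ($\theta$ known.) For every $\theta>0$ there exist estimators $\hat\beta=\hat\beta_n:\mathcal{G}_n\to\mathbb{R}$ (which may depend on $\theta$ but not on $\beta$) such that for every $\beta\in\mathbb{R}$, when $G$ is drawn from $\mathbb{P}_n$ with parameters $(\theta,\beta)$, $n(\hat\beta_n(G)-\beta)=O_P(1)$ as $n\to\infty$.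
   Context: Let $\mathcal{G}_n$ be the set of simple labeled graphs on $[n]=\{1,\dots,n\}$, identified with their symmetric $0/1$ adjacency matrices $G=(G_{ij})$ with $G_{ii}=0$. Let $d_i(G)=\sum_j G_{ij}$, $E(G)=\sum_{i<j}G_{ij}$, $T(G)=\sum_{i=1}^n\binom{d_i(G)}{2}$. Given $\omega_1>0,\omega_2\in\mathbb{R}$, the two-star model is the probability mass function on $\mathcal{G}_n$ $$\mathbb{P}_n(G=g)=\frac{1}{Z_n(\omega_1,\omega_2)}\exp\Big\{\Big(\omega_2+\frac{\omega_1}{n-1}\Big)E(g)+\frac{\omega_1}{n-1}T(g)\Big\},$$ with $Z_n$ the normalizing constant. The parameters are rewritten as $\theta:=\omega_1/4>0$, $\beta:=(\omega_1+\omega_2)/2\in\mathbb{R}$. A sequence of random vectors is $O_P(1)$ if it is tight. *)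

theory Defs
  imports "HOL-Probability.Probability"
begin

text \<open>
  Simple labeled graphs on \<open>{1..n}\<close>, as adjacency matrices. Entries outside the index range
  are set to 0, so that every graph is represented by exactly one function.
\<close>

type_synonym adjacency = "nat \<Rightarrow> nat \<Rightarrow> nat"

definition graphs :: "nat \<Rightarrow> adjacency set" where
  "graphs n = {g. (\<forall>i j. g i j \<in> {0, 1}) \<and> (\<forall>i j. g i j = g j i) \<and> (\<forall>i. g i i = 0) \<and>
                  (\<forall>i j. i \<notin> {1..n} \<or> j \<notin> {1..n} \<longrightarrow> g i j = 0)}"

definition vdegree :: "nat \<Rightarrow> adjacency \<Rightarrow> nat \<Rightarrow> nat" where
  "vdegree n g i = (\<Sum>j=1..n. g i j)"

definition num_edges :: "nat \<Rightarrow> adjacency \<Rightarrow> nat" where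
  "num_edges n g = (\<Sum>j=1..n. \<Sum>i=1..<j. g i j)"

definition num_two_stars :: "nat \<Rightarrow> adjacency \<Rightarrow> nat" where
  "num_two_stars n g = (\<Sum>i=1..n. vdegree n g i choose 2)"

text \<open>
  The model is meant for \<open>n \<ge> 2\<close>. For \<open>n \<le> 1\<close> the set of graphs is a singleton, hence the
  convention \<open>x / 0 = 0\<close> has no effect on the distribution.
\<close>

definition two_star_weight :: "real \<Rightarrow> real \<Rightarrow> nat \<Rightarrow> adjacency \<Rightarrow> real" where
  "two_star_weight \<omega>\<^sub>1 \<omega>\<^sub>2 n g =
     exp ((\<omega>\<^sub>2 + \<omega>\<^sub>1 / (real n - 1)) * real (num_edges n g)
          + \<omega>\<^sub>1 / (real n - 1) * real (num_two_stars n g))"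

definition two_star_Z :: "real \<Rightarrow> real \<Rightarrow> nat \<Rightarrow> real" where
  "two_star_Z \<omega>\<^sub>1 \<omega>\<^sub>2 n = (\<Sum>g\<in>graphs n. two_star_weight \<omega>\<^sub>1 \<omega>\<^sub>2 n g)"

definition two_star_pmf :: "real \<Rightarrow> real \<Rightarrow> nat \<Rightarrow> adjacency pmf" where
  "two_star_pmf \<omega>\<^sub>1 \<omega>\<^sub>2 n =
     embed_pmf (\<lambda>g. if g \<in> graphs n then two_star_weight \<omega>\<^sub>1 \<omega>\<^sub>2 n g / two_star_Z \<omega>\<^sub>1 \<omega>\<^sub>2 n else 0)"

text \<open>
  The parametrisation \<open>\<theta> = \<omega>\<^sub>1 / 4\<close>, \<open>\<beta> = (\<omega>\<^sub>1 + \<omega>\<^sub>2) / 2\<close>, solved for \<open>\<omega>\<^sub>1\<close> and \<open>\<omega>\<^sub>2\<close>.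
\<close>

definition two_star :: "real \<Rightarrow> real \<Rightarrow> nat \<Rightarrow> adjacency pmf" where
  "two_star \<theta> \<beta> n = two_star_pmf (4 * \<theta>) (2 * \<beta> - 4 * \<theta>) n"

text \<open>
  Tightness of a sequence of Borel probability measures; the constant \<open>tight\<close> of
  \<open>HOL-Probability\<close> only covers the real line. A sequence of random vectors \<open>X n\<close>, each
  on its own discrete probability space \<open>p n\<close>, is \<open>O\<^sub>P(1)\<close> if the sequence of its laws is tight.
\<close>

definition tight_seq :: "(nat \<Rightarrow> 'a::euclidean_space measure) \<Rightarrow> bool" where
  "tight_seq \<mu> \<longleftrightarrow> (\<forall>\<epsilon>>0. \<exists>K. compact K \<and> (\<forall>n. measure (\<mu> n) (- K) < \<epsilon>))"

definition bounded_in_prob ::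
  "(nat \<Rightarrow> 'b pmf) \<Rightarrow> (nat \<Rightarrow> 'b \<Rightarrow> 'a::euclidean_space) \<Rightarrow> bool" where
  "bounded_in_prob p X \<longleftrightarrow> tight_seq (\<lambda>n. distr (measure_pmf (p n)) borel (X n))"

lemma finite_graphs: "finite (graphs n)"
proof -
  let ?B = "{f :: nat \<Rightarrow> nat. \<forall>j. (j \<in> {1..n} \<longrightarrow> f j \<in> {0, 1}) \<and> (j \<notin> {1..n} \<longrightarrow> f j = 0)}"
  have "finite ?B"
    by (rule finite_set_of_finite_funs) auto
  then have "finite {g. \<forall>i. (i \<in> {1..n} \<longrightarrow> g i \<in> ?B) \<and> (i \<notin> {1..n} \<longrightarrow> g i = (\<lambda>_. 0))}"
    by (intro finite_set_of_finite_funs) auto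
  then show ?thesis
    by (rule rev_finite_subset) (auto simp: graphs_def fun_eq_iff)
qed

lemma two_star_Z_pos: "two_star_Z \<omega>\<^sub>1 \<omega>\<^sub>2 n > 0"
proof -
  have "(\<lambda>_ _. 0) \<in> graphs n"
    by (simp add: graphs_def)
  then have "graphs n \<noteq> {}"
    by blast
  then show ?thesis
    unfolding two_star_Z_def by (intro sum_pos finite_graphs) (auto simp: two_star_weight_def)
qed

lemma pmf_two_star_pmf:
  "pmf (two_star_pmf \<omega>\<^sub>1 \<omega>\<^sub>2 n) g =
     (if g \<in> graphs n then two_star_weight \<omega>\<^sub>1 \<omega>\<^sub>2 n g / two_star_Z \<omega>\<^sub>1 \<omega>\<^sub>2 n else 0)"
  unfolding two_star_pmf_def
proof (rule pmf_embed_pmf)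
  let ?w = "\<lambda>g. two_star_weight \<omega>\<^sub>1 \<omega>\<^sub>2 n g / two_star_Z \<omega>\<^sub>1 \<omega>\<^sub>2 n"
  have nn: "0 \<le> ?w g" for g
    using two_star_Z_pos[of \<omega>\<^sub>1 \<omega>\<^sub>2 n] by (simp add: two_star_weight_def)
  then show "0 \<le> (if g \<in> graphs n then ?w g else 0)" for g
    by simp
  have "(\<integral>\<^sup>+g. ennreal (if g \<in> graphs n then ?w g else 0) \<partial>count_space UNIV)
      = (\<integral>\<^sup>+g. ennreal (?w g) * indicator (graphs n) g \<partial>count_space UNIV)"
    by (intro nn_integral_cong) (auto simp: indicator_def)
  also have "\<dots> = (\<integral>\<^sup>+g. ennreal (?w g) \<partial>count_space (graphs n))"
    by (simp add: nn_integral_count_space_indicator)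
  also have "\<dots> = ennreal (\<Sum>g\<in>graphs n. ?w g)"
    using nn by (simp add: nn_integral_count_space_finite finite_graphs)
  also have "(\<Sum>g\<in>graphs n. ?w g) = 1"
    using two_star_Z_pos[of \<omega>\<^sub>1 \<omega>\<^sub>2 n]
    by (simp add: sum_divide_distrib[symmetric] two_star_Z_def[symmetric])
  finally show "(\<integral>\<^sup>+g. ennreal (if g \<in> graphs n then ?w g else 0) \<partial>count_space UNIV) = 1"
    by simp
qed

lemma two_star_reparam: "two_star (\<omega>\<^sub>1 / 4) ((\<omega>\<^sub>1 + \<omega>\<^sub>2) / 2) n = two_star_pmf \<omega>\<^sub>1 \<omega>\<^sub>2 n"
proof -
  have "4 * (\<omega>\<^sub>1 / 4) = \<omega>\<^sub>1" "2 * ((\<omega>\<^sub>1 + \<omega>\<^sub>2) / 2) - \<omega>\<^sub>1 = \<omega>\<^sub>2"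
    by (simp_all add: field_simps)
  then show ?thesis
    unfolding two_star_def by (simp only:)
qed

lemma bounded_in_prob_iff_norm:
  fixes X :: "nat \<Rightarrow> 'b \<Rightarrow> 'a::euclidean_space"
  shows "bounded_in_prob p X \<longleftrightarrow>
    (\<forall>\<epsilon>>0. \<exists>B. \<forall>n. measure_pmf.prob (p n) {x. norm (X n x) > B} < \<epsilon>)"
proof -
  have eq: "measure (distr (measure_pmf (p n)) borel (X n)) (- K)
      = measure_pmf.prob (p n) {x. X n x \<notin> K}" if "compact K" for n K
    using compact_imp_closed[OF that]
    by (subst measure_distr) (auto simp: vimage_def)
  show ?thesis
    unfolding bounded_in_prob_def tight_seq_def
  proof (intro iff_allI imp_cong refl iffI)
    fix \<epsilon> :: real
    assume "\<exists>K. compact K \<and> (\<forall>n. measure (distr (measure_pmf (p n)) borel (X n)) (- K) < \<epsilon>)"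
    then obtain K where K: "compact K"
      "\<And>n. measure_pmf.prob (p n) {x. X n x \<notin> K} < \<epsilon>"
      using eq by auto
    obtain B where "\<And>x. x \<in> K \<Longrightarrow> norm x \<le> B"
      using compact_imp_bounded[OF K(1)] by (auto simp: bounded_iff)
    then have "measure_pmf.prob (p n) {x. norm (X n x) > B}
        \<le> measure_pmf.prob (p n) {x. X n x \<notin> K}" for n
      by (intro measure_pmf.finite_measure_mono) force+
    then show "\<exists>B. \<forall>n. measure_pmf.prob (p n) {x. norm (X n x) > B} < \<epsilon>"
      using K(2) by (meson le_less_trans)
  next
    fix \<epsilon> :: real
    assume "\<exists>B. \<forall>n. measure_pmf.prob (p n) {x. norm (X n x) > B} < \<epsilon>"
    then obtain B where "\<And>n. measure_pmf.prob (p n) {x. norm (X n x) > B} < \<epsilon>"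
      by blast
    then show "\<exists>K. compact K \<and> (\<forall>n. measure (distr (measure_pmf (p n)) borel (X n)) (- K) < \<epsilon>)"
      by (intro exI[of _ "cball 0 B"]) (simp add: eq not_le)
  qed
qed

end

theory Submission
  imports Defs
begin

text \<open>
  In the spins \<open>y\<^sub>i\<^sub>j = 2 g\<^sub>i\<^sub>j - 1\<close> the model is an Ising model in which, given all other edges,
  \<open>y\<^sub>i\<^sub>j\<close> has mean \<open>tanh (\<beta> + \<theta> t\<^sub>i\<^sub>j)\<close> with \<open>t\<^sub>i\<^sub>j\<close> the normalised sum of the spins of the adjacent
  edges. Let \<open>r\<^sub>i\<^sub>j\<close> be the difference. The estimators nearly solve the pseudo-likelihood equations
  \<open>S = \<Sum> r\<^sub>i\<^sub>j = 0\<close> and \<open>Q = \<Sum> c\<^sub>i\<^sub>j r\<^sub>i\<^sub>j = 0\<close>, where \<open>c\<^sub>i\<^sub>j\<close> is the centred version of \<open>t\<^sub>i\<^sub>j\<close>.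

  Weight times residual is antisymmetric under flipping an edge, hence
  \<open>E[r\<^sub>e F] = E[r\<^sub>e (F - F \<circ> flip\<^sub>e)] / 2\<close>. With \<open>V\<close> the sum of squared degree deviations this yields
  \<open>E[S\<^sup>2] = O(n\<^sup>2)\<close> and \<open>E[Q\<^sup>2 / (V + n\<^sup>2)] = O(n)\<close>. The self-normalisation makes an upper bound on \<open>V\<close>
  unnecessary, so that no information on the phase of the model enters. A Taylor expansion of \<open>Q\<close>
  shows that \<open>V\<close> is of order at least \<open>n\<^sup>2\<close> whenever \<open>Q\<close> is small, and then strict monotonicity of tanh
  makes two pairs of parameters for which both scores are small close to each other.
\<close>

text \<open>The rates come from a change of coordinates. Put \<open>v = \<theta>' - \<theta>\<close>
  and let \<open>u\<close> be the change of \<open>\<beta> + \<theta> * t\<close> at the mean field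
  \<open>t = 2 * avg n y / (n - 1)\<close>. At an edge the argument of tanh then moves by
  \<open>u + v * coef / (n - 1)\<close>, and the squares of these changes add up to the order of
  \<open>n^2 * u^2 + v^2 * V / n\<close>. As S is of order n and Q of order
  \<open>sqrt (n * V)\<close> once V is at least of order \<open>n^2\<close>, u is determined up to
  1/n and v up to \<open>sqrt (n / V)\<close>, hence up to \<open>1 / sqrt n\<close>. The error of
  \<beta> is u minus a bounded multiple of v and inherits the slower rate; for known \<theta> it is
  u itself.

  The obstacle is the size of V. A flip changes Q by an amount containing the deviations at its end
  points, so the second moment of Q scales with V, whose typical size depends on the phase;
  deterministically it is only bounded by \<open>n^3\<close>. The normaliser \<open>V + n^2\<close>
  varies slowly under a flip, so the flip identity survives the weighting.

  The lower bound on V rests on the term \<open>- 2 * y i j\<close> in \<open>coef\<close>: a spin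
  does not enter its own field, and this alone would give Q the size \<open>n^2\<close> if V were
  much smaller.\<close>

declare One_nat_def [simp del]

section \<open>Increments of the hyperbolic tangent\<close>

lemma abs_tanh_real_less_1: "\<bar>tanh x\<bar> < (1::real)"
  using tanh_real_lt_1[of x] tanh_real_gt_neg1[of x] by linarith

lemma abs_tanh_diff_le: "\<bar>tanh x - tanh y\<bar> \<le> \<bar>x - (y::real)\<bar>"
proof -
  have "norm (tanh x - tanh y) \<le> 1 * norm (x - y)"
  proof (rule field_differentiable_bound[where S = UNIV and f' = "\<lambda>z. 1 - tanh z ^ 2"])
    show "(tanh has_field_derivative 1 - (tanh z)\<^sup>2) (at z within UNIV)" for z :: real
      by (auto intro!: derivative_eq_intros)
    show "norm (1 - (tanh z)\<^sup>2) \<le> 1" for z :: real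
      using abs_tanh_real_less_1[of z] using abs_square_le_1[of "tanh z"] by simp
  qed auto
  then show ?thesis by simp
qed

text \<open>This is \<open>exp (2 * x) \<ge> 1 + 2 * x\<close> rewritten. The fraction is linear
  near 0 and bounded at infinity, as tanh is, so it serves for increments of any size.\<close>

lemma tanh_real_ge_frac: "x / (1 + x) \<le> tanh x" if "x \<ge> 0" for x :: real
proof -
  define q where "q = exp (- 2 * x)"
  have q: "q > 0" by (simp add: q_def)
  have "(1 + 2 * x) * q \<le> exp (2 * x) * q"
    using exp_ge_add_one_self[of "2 * x"] q by (intro mult_right_mono) auto
  also have "exp (2 * x) * q = 1" by (simp add: q_def mult_exp_exp)
  finally have "x * (1 + q) \<le> (1 - q) * (1 + x)" by (simp add: algebra_simps)
  then have "x / (1 + x) \<le> (1 - q) / (1 + q)"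
    using q that by (simp add: field_simps)
  then show ?thesis by (simp add: tanh_real_altdef q_def)
qed

lemma abs_tanh_real_ge_frac: "\<bar>x\<bar> / (1 + \<bar>x\<bar>) \<le> \<bar>tanh x\<bar>" for x :: real
  using tanh_real_ge_frac[of "\<bar>x\<bar>"] by simp

text \<open>The addition formula, arranged so that the last factor is bounded below by a bound on
  \<open>x\<close> alone.\<close>

lemma tanh_diff_real: "tanh (x + w) - tanh x = tanh w * (1 - tanh x * tanh (x + w))" for x w :: real
proof -
  have "\<bar>tanh x * tanh w\<bar> < 1 * 1"
    unfolding abs_mult using abs_tanh_real_less_1 by (intro mult_strict_mono') auto
  then have "1 + tanh x * tanh w \<noteq> 0" by linarith
  moreover have "tanh (x + w) = (tanh x + tanh w) / (1 + tanh x * tanh w)"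
    by (rule tanh_add) simp_all
  ultimately show ?thesis by (simp add: field_simps)
qed

text \<open>Quantitative strict monotonicity. In the application \<open>x\<close> belongs to the
  true parameters and is bounded, while \<open>w\<close> comes from an estimate and may have any
  size; hence a bound that is quadratic for small \<open>w\<close> and linear for large
  \<open>w\<close>.\<close>

lemma tanh_increment_ge:
  fixes x w :: real
  assumes "\<bar>x\<bar> \<le> M"
  shows "(1 - tanh M) * (w\<^sup>2 / (1 + \<bar>w\<bar>)) \<le> w * (tanh (x + w) - tanh x)"
proof -
  have "\<bar>tanh x\<bar> \<le> tanh M"
    using assms by (simp flip: tanh_real_abs)
  moreover have "\<bar>tanh x * tanh (x + w)\<bar> \<le> \<bar>tanh x\<bar> * 1"
    unfolding abs_mult using abs_tanh_real_less_1[of "x + w"] by (intro mult_left_mono) auto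
  ultimately have *: "1 - tanh M \<le> 1 - tanh x * tanh (x + w)" by linarith
  have M: "tanh M < 1" by (rule tanh_real_lt_1)
  have abs: "\<bar>tanh (x + w) - tanh x\<bar> = \<bar>tanh w\<bar> * (1 - tanh x * tanh (x + w))"
    unfolding tanh_diff_real abs_mult using * M by simp
  have 1: "(1 - tanh M) * (\<bar>w\<bar> / (1 + \<bar>w\<bar>)) \<le> \<bar>tanh (x + w) - tanh x\<bar>"
    unfolding abs using mult_mono[OF abs_tanh_real_ge_frac *, of w] M by (simp add: mult.commute)
  have "w * (tanh (x + w) - tanh x) = \<bar>w\<bar> * \<bar>tanh (x + w) - tanh x\<bar>"
    by (cases "w \<ge> 0") (auto simp: abs_if not_le not_less algebra_simps)
  moreover have "\<bar>w\<bar> * ((1 - tanh M) * (\<bar>w\<bar> / (1 + \<bar>w\<bar>))) = (1 - tanh M) * (w\<^sup>2 / (1 + \<bar>w\<bar>))"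
    by (simp add: power2_eq_square)
  ultimately show "(1 - tanh M) * (w\<^sup>2 / (1 + \<bar>w\<bar>)) \<le> w * (tanh (x + w) - tanh x)"
    using mult_left_mono[OF 1 abs_ge_zero[of w]] by (simp only:)
qed

section \<open>Spin configurations and edge flips\<close>

definition spins :: "nat \<Rightarrow> (nat \<Rightarrow> nat \<Rightarrow> real) \<Rightarrow> bool" where
  "spins n y \<longleftrightarrow> (\<forall>i j. y i j = y j i) \<and> (\<forall>i. y i i = 0) \<and>
     (\<forall>i\<in>{1..n}. \<forall>j\<in>{1..n}. i \<noteq> j \<longrightarrow> y i j = 1 \<or> y i j = -1)"

definition rowsum :: "nat \<Rightarrow> (nat \<Rightarrow> nat \<Rightarrow> real) \<Rightarrow> nat \<Rightarrow> real" where
  "rowsum n y i = (\<Sum>j=1..n. y i j)"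

definition avg :: "nat \<Rightarrow> (nat \<Rightarrow> nat \<Rightarrow> real) \<Rightarrow> real" where
  "avg n y = (\<Sum>i=1..n. rowsum n y i) / real n"

definition dev :: "nat \<Rightarrow> (nat \<Rightarrow> nat \<Rightarrow> real) \<Rightarrow> nat \<Rightarrow> real" where
  "dev n y i = rowsum n y i - avg n y"

definition dispersion :: "nat \<Rightarrow> (nat \<Rightarrow> nat \<Rightarrow> real) \<Rightarrow> real" where
  "dispersion n y = (\<Sum>i=1..n. (dev n y i)\<^sup>2)"

text \<open>Each of the two row sums contains the spin of the edge once; the subtraction leaves the
  edges sharing exactly one end point with it.\<close>

definition field :: "nat \<Rightarrow> (nat \<Rightarrow> nat \<Rightarrow> real) \<Rightarrow> nat \<Rightarrow> nat \<Rightarrow> real" where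
  "field n y i j = (rowsum n y i + rowsum n y j - 2 * y i j) / (real n - 1)"

text \<open>For \<open>n \<ge> 2\<close> this is \<open>n - 1\<close> times the field, minus the
  mean-field value \<open>2 * avg n y\<close>.\<close>

definition coef :: "nat \<Rightarrow> (nat \<Rightarrow> nat \<Rightarrow> real) \<Rightarrow> nat \<Rightarrow> nat \<Rightarrow> real" where
  "coef n y i j = dev n y i + dev n y j - 2 * y i j"

text \<open>The diagonal is excluded: \<open>y i i = 0\<close> is not a spin.\<close>

definition resid :: "real \<Rightarrow> real \<Rightarrow> nat \<Rightarrow> (nat \<Rightarrow> nat \<Rightarrow> real) \<Rightarrow> nat \<Rightarrow> nat \<Rightarrow> real" where
  "resid \<theta> \<beta> n y i j = (if i = j then 0 else y i j - tanh (\<beta> + \<theta> * field n y i j))"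

definition row_resid :: "real \<Rightarrow> real \<Rightarrow> nat \<Rightarrow> (nat \<Rightarrow> nat \<Rightarrow> real) \<Rightarrow> nat \<Rightarrow> real" where
  "row_resid \<theta> \<beta> n y i = (\<Sum>j=1..n. resid \<theta> \<beta> n y i j)"

definition score :: "real \<Rightarrow> real \<Rightarrow> nat \<Rightarrow> (nat \<Rightarrow> nat \<Rightarrow> real) \<Rightarrow> real" where
  "score \<theta> \<beta> n y = (\<Sum>i=1..n. row_resid \<theta> \<beta> n y i)"

definition centred_score :: "real \<Rightarrow> real \<Rightarrow> nat \<Rightarrow> (nat \<Rightarrow> nat \<Rightarrow> real) \<Rightarrow> real" where
  "centred_score \<theta> \<beta> n y = (\<Sum>i=1..n. \<Sum>j=1..n. coef n y i j * resid \<theta> \<beta> n y i j)"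

definition flip :: "nat \<Rightarrow> nat \<Rightarrow> (nat \<Rightarrow> nat \<Rightarrow> real) \<Rightarrow> nat \<Rightarrow> nat \<Rightarrow> real" where
  "flip a b y = (\<lambda>i j. if (i = a \<and> j = b) \<or> (i = b \<and> j = a) then - y i j else y i j)"

text \<open>The end points of the edge \<open>{a, b}\<close>, and the edge itself as an unordered pair.\<close>

definition inc :: "nat \<Rightarrow> nat \<Rightarrow> nat \<Rightarrow> real" where
  "inc a b i = of_bool (i = a) + of_bool (i = b)"

definition same_edge :: "nat \<Rightarrow> nat \<Rightarrow> nat \<Rightarrow> nat \<Rightarrow> real" where
  "same_edge a b i j = of_bool (i = a) * of_bool (j = b) + of_bool (i = b) * of_bool (j = a)"

lemma spins_flip: "spins n y \<Longrightarrow> spins n (flip a b y)"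
  unfolding spins_def flip_def by (smt (verit))

lemma spins_sym: "spins n y \<Longrightarrow> y i j = y j i"
  unfolding spins_def by blast

lemma spins_diag: "spins n y \<Longrightarrow> y i i = 0"
  unfolding spins_def by blast

lemma spins_square: "spins n y \<Longrightarrow> i \<in> {1..n} \<Longrightarrow> j \<in> {1..n} \<Longrightarrow> i \<noteq> j \<Longrightarrow> (y i j)\<^sup>2 = 1"
  unfolding spins_def by (metis power2_eq_1_iff)

lemma spins_abs: "spins n y \<Longrightarrow> i \<in> {1..n} \<Longrightarrow> j \<in> {1..n} \<Longrightarrow> i \<noteq> j \<Longrightarrow> \<bar>y i j\<bar> = 1"
  unfolding spins_def by (metis abs_1 abs_minus_cancel)

lemma spins_abs_le: "spins n y \<Longrightarrow> i \<in> {1..n} \<Longrightarrow> j \<in> {1..n} \<Longrightarrow> \<bar>y i j\<bar> \<le> 1"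
  by (cases "i = j") (auto simp: spins_diag spins_abs)

context
  fixes n a b :: nat
  assumes a: "a \<in> {1..n}" and b: "b \<in> {1..n}"
begin

lemma sum_inc_mult: "(\<Sum>i=1..n. inc a b i * f i) = f a + f b"
  using a b by (simp add: inc_def distrib_right sum.distrib of_bool_def if_distrib[of "\<lambda>x. x * _"] cong: if_cong)

lemma sum_inc: "(\<Sum>i=1..n. inc a b i) = 2"
  using sum_inc_mult[of "\<lambda>_. 1"] by simp

lemma sum_same_edge_row: "(\<Sum>j=1..n. same_edge a b i j * f j) = of_bool (i = a) * f b + of_bool (i = b) * f a"
  using a b by (auto simp: same_edge_def distrib_right sum.distrib of_bool_def if_distrib[of "\<lambda>x. x * _"] cong: if_cong)

lemma sum_same_edge_mult: "(\<Sum>i=1..n. \<Sum>j=1..n. same_edge a b i j * f i j) = f a b + f b a"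
  unfolding sum_same_edge_row
  using a b by (simp add: sum.distrib of_bool_def if_distrib[of "\<lambda>x. x * _"] cong: if_cong)

lemma sum_same_edge: "(\<Sum>j=1..n. same_edge a b i j) = inc a b i"
  using sum_same_edge_row[of i "\<lambda>_. 1"] by (simp add: inc_def)

end

section \<open>Effect of a flip on row sums, fields and residuals\<close>

context
  fixes n :: nat and y :: "nat \<Rightarrow> nat \<Rightarrow> real" and a b :: nat
  assumes y: "spins n y" and a: "a \<in> {1..n}" and b: "b \<in> {1..n}" and ab: "a \<noteq> b"
begin

text \<open>As an additive perturbation the flip acts on every linear statistic by summing
  \<open>same_edge\<close>. For equal end points \<open>same_edge\<close> would be 2 on the
  diagonal.\<close>

lemma flip_eq: "flip a b y i j = y i j - 2 * y a b * same_edge a b i j"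
  using ab spins_sym[OF y, of a b] by (auto simp: flip_def same_edge_def)

lemma n_ge_2: "2 \<le> n"
  using a b ab by auto

lemma rowsum_flip: "rowsum n (flip a b y) i = rowsum n y i - 2 * y a b * inc a b i"
  unfolding rowsum_def flip_eq sum_subtractf sum_distrib_left[symmetric] sum_same_edge[OF a b] ..

lemma avg_flip: "avg n (flip a b y) = avg n y - 4 * y a b / n"
  unfolding avg_def rowsum_flip sum_subtractf sum_distrib_left[symmetric]
  by (simp add: sum_inc[OF a b] diff_divide_distrib)

lemma dev_flip: "dev n (flip a b y) i = dev n y i - 2 * y a b * inc a b i + 4 * y a b / n"
  unfolding dev_def rowsum_flip avg_flip by simp

lemma coef_flip:
  "coef n (flip a b y) i j =
     coef n y i j - y a b * (2 * inc a b i + 2 * inc a b j - 4 * same_edge a b i j - 8 / n)"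
  unfolding coef_def dev_flip flip_eq by (simp add: algebra_simps)

lemma field_flip:
  "field n (flip a b y) i j =
     field n y i j - 2 * y a b * (inc a b i + inc a b j - 2 * same_edge a b i j) / (real n - 1)"
  unfolding field_def rowsum_flip flip_eq by (simp add: diff_divide_distrib[symmetric] algebra_simps)

text \<open>Two effects: the spin itself changes by 2 on the edge, and the conditional means at
  edges touching an end point move by O(1/n), since tanh is 1-Lipschitz.\<close>

lemma abs_resid_flip_le:
  assumes "\<theta> \<ge> 0"
  shows "\<bar>resid \<theta> \<beta> n y i j - resid \<theta> \<beta> n (flip a b y) i j\<bar> \<le>
    2 * same_edge a b i j + 2 * \<theta> / (real n - 1) * (inc a b i + inc a b j)"
proof (cases "i = j")
  case False
  define s where "s = inc a b i + inc a b j - 2 * same_edge a b i j"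
  have s: "0 \<le> s" "s \<le> inc a b i + inc a b j"
    using ab False by (auto simp: s_def inc_def same_edge_def)
  have y1: "\<bar>y a b\<bar> = 1" using spins_abs[OF y a b ab] .
  have n1: "real n - 1 > 0" using n_ge_2 by simp
  let ?x = "\<beta> + \<theta> * field n y i j" and ?x' = "\<beta> + \<theta> * field n (flip a b y) i j"
  have "\<bar>tanh ?x - tanh ?x'\<bar> \<le> \<bar>?x - ?x'\<bar>" by (rule abs_tanh_diff_le)
  also have "?x - ?x' = 2 * \<theta> / (real n - 1) * s * y a b"
    unfolding field_flip s_def using n1 by (simp add: field_simps)
  also have "\<bar>\<dots>\<bar> = 2 * \<theta> / (real n - 1) * s"
    using y1 s n1 assms by (simp add: abs_mult)
  also have "\<dots> \<le> 2 * \<theta> / (real n - 1) * (inc a b i + inc a b j)"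
    using s n1 assms by (intro mult_left_mono) auto
  finally have *: "\<bar>tanh ?x - tanh ?x'\<bar> \<le> 2 * \<theta> / (real n - 1) * (inc a b i + inc a b j)" .
  have "\<bar>y i j - flip a b y i j\<bar> = 2 * same_edge a b i j"
    unfolding flip_eq using y1 by (simp add: abs_mult same_edge_def)
  then show ?thesis using * False unfolding resid_def by simp
qed (use assms n_ge_2 in \<open>simp add: resid_def inc_def same_edge_def\<close>)

lemma n_frac_le: "real n / (real n - 1) \<le> 2"
  using n_ge_2 by (simp add: field_simps)

lemma abs_row_resid_flip_le:
  assumes "\<theta> \<ge> 0"
  shows "\<bar>row_resid \<theta> \<beta> n y i - row_resid \<theta> \<beta> n (flip a b y) i\<bar> \<le> 2 + 8 * \<theta>"
proof -
  have "\<bar>row_resid \<theta> \<beta> n y i - row_resid \<theta> \<beta> n (flip a b y) i\<bar>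
      \<le> (\<Sum>j=1..n. 2 * same_edge a b i j + 2 * \<theta> / (real n - 1) * (inc a b i + inc a b j))"
    unfolding row_resid_def sum_subtractf[symmetric]
    by (rule order_trans[OF sum_abs sum_mono[OF abs_resid_flip_le[OF assms]]])
  also have "\<dots> = 2 * inc a b i + 2 * \<theta> / (real n - 1) * (n * inc a b i + 2)"
    unfolding sum.distrib sum_distrib_left[symmetric] sum_same_edge[OF a b] sum_inc[OF a b] by simp
  \<comment> \<open>\<open>inc a b i\<close> is at most 1 because the end points differ; the summand
    2 is absorbed by \<open>n\<close>.\<close>
  also have "\<dots> \<le> 2 * 1 + 2 * \<theta> / (real n - 1) * (n * 1 + n)"
    using ab n_ge_2 assms by (intro add_mono mult_left_mono) (auto simp: inc_def)
  also have "\<dots> = 2 + 4 * \<theta> * (n / (real n - 1))" by simp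
  also have "\<dots> \<le> 2 + 4 * \<theta> * 2"
    using n_frac_le assms by (intro add_mono mult_left_mono) auto
  finally show ?thesis by simp
qed

text \<open>The conditional means change by O(1/n) at O(n) edges, so even the full double sum moves
  by a bounded amount.\<close>

lemma abs_score_flip_le:
  assumes "\<theta> \<ge> 0"
  shows "\<bar>score \<theta> \<beta> n y - score \<theta> \<beta> n (flip a b y)\<bar> \<le> 4 + 16 * \<theta>"
proof -
  have "\<bar>score \<theta> \<beta> n y - score \<theta> \<beta> n (flip a b y)\<bar>
      \<le> (\<Sum>i=1..n. \<Sum>j=1..n. 2 * same_edge a b i j + 2 * \<theta> / (real n - 1) * (inc a b i + inc a b j))"
    unfolding score_def row_resid_def sum_subtractf[symmetric]
    by (intro order_trans[OF sum_abs] sum_mono abs_resid_flip_le[OF assms])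
  also have "\<dots> = 4 + 2 * \<theta> / (real n - 1) * (4 * n)"
    unfolding sum.distrib sum_distrib_left[symmetric] sum_same_edge[OF a b] sum_inc[OF a b]
    by (simp add: sum.distrib sum_distrib_left[symmetric] sum_inc[OF a b])
  also have "\<dots> = 4 + 8 * \<theta> * (n / (real n - 1))" by simp
  also have "\<dots> \<le> 4 + 8 * \<theta> * 2"
    using n_frac_le assms by (intro add_mono mult_left_mono) auto
  finally show ?thesis by simp
qed

end

section \<open>A priori bounds for a single configuration\<close>

context
  fixes n :: nat and y :: "nat \<Rightarrow> nat \<Rightarrow> real"
  assumes y: "spins n y"
begin

lemma resid_sym: "resid \<theta> \<beta> n y i j = resid \<theta> \<beta> n y j i"
  using spins_sym[OF y, of i j] by (simp add: resid_def field_def add.commute)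

lemma abs_resid_le: "i \<in> {1..n} \<Longrightarrow> j \<in> {1..n} \<Longrightarrow> \<bar>resid \<theta> \<beta> n y i j\<bar> \<le> 2"
  using spins_abs_le[OF y, of i j] abs_tanh_real_less_1[of "\<beta> + \<theta> * field n y i j"]
  unfolding resid_def by auto

lemma abs_coef_le:
  "i \<in> {1..n} \<Longrightarrow> j \<in> {1..n} \<Longrightarrow> \<bar>coef n y i j\<bar> \<le> \<bar>dev n y i\<bar> + \<bar>dev n y j\<bar> + 2"
  using spins_abs_le[OF y, of i j] unfolding coef_def by linarith

lemma abs_rowsum_le: "i \<in> {1..n} \<Longrightarrow> \<bar>rowsum n y i\<bar> \<le> real n - 1"
proof -
  assume i: "i \<in> {1..n}"
  have "rowsum n y i = (\<Sum>j\<in>{1..n} - {i}. y i j)"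
    using i spins_diag[OF y] by (simp add: rowsum_def sum_diff1)
  also have "\<bar>\<dots>\<bar> \<le> (\<Sum>j\<in>{1..n} - {i}. 1)"
    using i spins_abs_le[OF y] by (intro order_trans[OF sum_abs] sum_mono) auto
  also have "\<dots> = real n - 1" using i by (simp add: of_nat_diff)
  finally show ?thesis .
qed

lemma abs_avg_le: "n \<ge> 1 \<Longrightarrow> \<bar>avg n y\<bar> \<le> real n - 1"
proof -
  assume n: "n \<ge> 1"
  have "\<bar>\<Sum>i=1..n. rowsum n y i\<bar> \<le> (\<Sum>i=1..n. real n - 1)"
    using abs_rowsum_le by (intro order_trans[OF sum_abs] sum_mono) auto
  also have "\<dots> = (real n - 1) * n" by simp
  finally show ?thesis using n by (simp add: avg_def abs_divide field_simps)
qed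

lemma abs_dev_le: "i \<in> {1..n} \<Longrightarrow> \<bar>dev n y i\<bar> \<le> 2 * real n"
  using abs_rowsum_le[of i] abs_avg_le unfolding dev_def by force

lemma sum_rowsum: "(\<Sum>i=1..n. rowsum n y i) = n * avg n y"
  by (simp add: avg_def)

lemma sum_dev: "(\<Sum>i=1..n. dev n y i) = 0"
  unfolding dev_def sum_subtractf by (simp add: sum_rowsum)

lemma dispersion_eq: "dispersion n y = (\<Sum>i=1..n. dev n y i * rowsum n y i)"
proof -
  have "(dev n y i)\<^sup>2 = dev n y i * rowsum n y i - avg n y * dev n y i" for i
    by (simp add: dev_def power2_eq_square algebra_simps)
  then show ?thesis
    by (simp add: dispersion_def sum_subtractf sum_distrib_left[symmetric] sum_dev)
qed

lemma dispersion_nonneg: "dispersion n y \<ge> 0"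
  unfolding dispersion_def by (intro sum_nonneg) auto

text \<open>Crude, but valid in every phase. It is needed only to bound the reciprocal of the
  normaliser.\<close>

lemma dispersion_le: "dispersion n y \<le> real n ^ 3"
proof -
  have "dispersion n y = (\<Sum>i=1..n. (rowsum n y i)\<^sup>2) - avg n y * (\<Sum>i=1..n. rowsum n y i)"
    unfolding dispersion_eq dev_def by (simp add: algebra_simps power2_eq_square sum_subtractf sum_distrib_left)
  also have "\<dots> \<le> (\<Sum>i=1..n. (rowsum n y i)\<^sup>2)"
    unfolding sum_rowsum by (simp add: mult.left_commute)
  also have "\<dots> \<le> (\<Sum>i=1..n. (real n)\<^sup>2)"
    using abs_rowsum_le by (intro sum_mono abs_le_square_iff[THEN iffD1]) force
  finally show ?thesis by (simp add: power2_eq_square power3_eq_cube)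
qed

lemma sum_sq_bound:
  "(\<Sum>i=1..n. \<Sum>j=1..n. (\<bar>dev n y i\<bar> + \<bar>dev n y j\<bar> + 2)\<^sup>2) \<le> 6 * n * dispersion n y + 12 * (real n)\<^sup>2"
proof -
  have "(p + q + 2)\<^sup>2 \<le> 3 * p\<^sup>2 + 3 * q\<^sup>2 + 12" for p q :: real
    using zero_le_power2[of "p - q"] zero_le_power2[of "p - 2"] zero_le_power2[of "q - 2"]
    by (simp add: power2_eq_square algebra_simps)
  then have "(\<Sum>i=1..n. \<Sum>j=1..n. (\<bar>dev n y i\<bar> + \<bar>dev n y j\<bar> + 2)\<^sup>2)
     \<le> (\<Sum>i=1..n. \<Sum>j=1..n. 3 * \<bar>dev n y i\<bar>\<^sup>2 + 3 * \<bar>dev n y j\<bar>\<^sup>2 + 12)"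
    by (intro sum_mono)
  also have "\<dots> = 6 * n * dispersion n y + 12 * (real n)\<^sup>2"
    unfolding dispersion_def
    by (simp add: sum.distrib sum_distrib_left[symmetric] power2_eq_square algebra_simps)
  finally show ?thesis .
qed

end

section \<open>Effect of a flip on the quadratic statistics\<close>

context
  fixes n :: nat and y :: "nat \<Rightarrow> nat \<Rightarrow> real" and a b :: nat
  assumes y: "spins n y" and a: "a \<in> {1..n}" and b: "b \<in> {1..n}" and ab: "a \<noteq> b"
begin

text \<open>A quadratic statistic changes linearly in the deviations at the two end points; this is
  where deviations enter all later flip bounds.\<close>

lemma abs_dispersion_flip_le:
  "\<bar>dispersion n y - dispersion n (flip a b y)\<bar> \<le> 4 * (\<bar>dev n y a\<bar> + \<bar>dev n y b\<bar> + 2)"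
proof -
  define s where "s = y a b"
  have s: "\<bar>s\<bar> = 1" "s * s = 1" using spins_abs[OF y a b ab] spins_square[OF y a b ab] by (auto simp: s_def power2_eq_square)
  have n: "real n \<ge> 2" using n_ge_2[OF y a b ab] by simp
  have ii: "inc a b i * inc a b i = inc a b i" for i using ab by (auto simp: inc_def)
  have "(dev n (flip a b y) i)\<^sup>2 = (dev n y i)\<^sup>2 - 4 * s * (inc a b i * dev n y i) + 8 * s / n * dev n y i
      + 4 * inc a b i - 16 / n * inc a b i + 16 / (real n)\<^sup>2" for i
  proof -
    have "(dev n (flip a b y) i)\<^sup>2 = (dev n y i)\<^sup>2 - 4 * s * (inc a b i * dev n y i) + 8 * s / n * dev n y i
      + 4 * (s * s) * (inc a b i * inc a b i) - 16 / n * (s * s) * inc a b i + 16 / (real n)\<^sup>2 * (s * s)"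
      unfolding dev_flip[OF y a b ab] s_def[symmetric]
      using n by (simp add: power2_eq_square field_simps)
    then show ?thesis unfolding s ii by simp
  qed
  \<comment> \<open>The terms \<open>8 * s / n * dev n y i\<close> cancel in the sum, and
    \<open>16 / n\<close> is \<open>n\<close> times the constant \<open>16 / n^2\<close>.\<close>
  then have "dispersion n (flip a b y) = dispersion n y - 4 * s * (dev n y a + dev n y b) + 8 - 32 / n + 16 / n"
    using n sum_inc_mult[OF a b] unfolding dispersion_def
    by (simp add: sum.distrib sum_subtractf sum_distrib_left[symmetric] sum_dev[OF y] sum_inc[OF a b]
        sum_divide_distrib[symmetric] power2_eq_square)
  moreover define x where "x = s * (dev n y a + dev n y b)"
  ultimately have "dispersion n y - dispersion n (flip a b y) = 4 * x - (8 - 16 / n)"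
    by (simp add: field_simps)
  moreover have "\<bar>x\<bar> \<le> \<bar>dev n y a\<bar> + \<bar>dev n y b\<bar>"
    unfolding x_def abs_mult s by simp
  moreover have "0 \<le> 8 - 16 / n" "16 / real n \<ge> 0" using n by (simp_all add: field_simps)
  moreover have "\<bar>4 * x - z\<bar> \<le> 4 * (p + q + 2)" if "\<bar>x\<bar> \<le> p + q" "0 \<le> z" "z \<le> 8" for p q z
    using that unfolding abs_le_iff by simp
  ultimately show ?thesis by simp
qed

text \<open>With primes for the flipped configuration,
  \<open>c * r - c' * r' = (c - c') * r + c' * (r - r')\<close>. The first part is summed exactly
  and leaves row residuals, whose second moments are O(n); in the second part \<open>r - r'\<close>
  is O(1/n) off the edge, so absolute values suffice.\<close>

lemma abs_centred_score_flip_le: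
  fixes \<theta> \<beta> :: real
  assumes \<theta>: "\<theta> \<ge> 0"
  defines "R \<equiv> row_resid \<theta> \<beta> n y" and "d \<equiv> dev n y"
  shows "\<bar>centred_score \<theta> \<beta> n y - centred_score \<theta> \<beta> n (flip a b y)\<bar> \<le>
    (72 + 224 * \<theta>) * (1 + \<bar>R a\<bar> + \<bar>R b\<bar> + \<bar>score \<theta> \<beta> n y\<bar> / n + \<bar>d a\<bar> + \<bar>d b\<bar> + (\<Sum>j=1..n. \<bar>d j\<bar>) / n)"
proof -
  define y' where "y' = flip a b y"
  define r r' c c' where "r = resid \<theta> \<beta> n y" and "r' = resid \<theta> \<beta> n y'"
    and "c = coef n y" and "c' = coef n y'"
  define S where "S = score \<theta> \<beta> n y"
  define D where "D = (\<Sum>j=1..n. \<bar>d j\<bar>)"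
  have n: "real n \<ge> 2" using n_ge_2[OF y a b ab] by simp
  have s: "\<bar>y a b\<bar> = 1" using spins_abs[OF y a b ab] .
  have D: "D \<ge> 0" unfolding D_def by (intro sum_nonneg) auto
  have dc: "c i j - c' i j = y a b * (2 * inc a b i + 2 * inc a b j - 4 * same_edge a b i j - 8 / n)" for i j
    unfolding c_def c'_def y'_def coef_flip[OF y a b ab] by simp
  have row1: "(\<Sum>i=1..n. \<Sum>j=1..n. inc a b i * r i j) = R a + R b"
    unfolding sum_distrib_left[symmetric] using sum_inc_mult[OF a b]
    by (simp add: R_def r_def row_resid_def)
  have row2: "(\<Sum>i=1..n. \<Sum>j=1..n. inc a b j * r i j) = R a + R b"
    using row1 resid_sym[OF y] by (subst sum.swap) (simp add: r_def)
  have tot: "(\<Sum>i=1..n. \<Sum>j=1..n. r i j) = S"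
    by (simp add: S_def score_def row_resid_def r_def)
  \<comment> \<open>No absolute values inside the sum: termwise bounds would give order n instead of
    the typical order \<open>sqrt n\<close> of a row residual.\<close>
  have 1: "(\<Sum>i=1..n. \<Sum>j=1..n. (c i j - c' i j) * r i j) =
     y a b * (4 * (R a + R b) - 4 * (r a b + r b a) - 8 / n * S)"
  proof -
    have "(c i j - c' i j) * r i j = y a b * (2 * (inc a b i * r i j) + 2 * (inc a b j * r i j) - 4 * (same_edge a b i j * r i j) - 8 / n * r i j)" for i j
      unfolding dc by (simp add: algebra_simps)
    then show ?thesis
      by (simp add: sum.distrib sum_subtractf sum_distrib_left[symmetric] sum_divide_distrib[symmetric] row1[unfolded sum_distrib_left[symmetric]] row2 tot sum_same_edge_mult[OF a b])
  qed
  have rb: "\<bar>r a b\<bar> \<le> 2" "\<bar>r b a\<bar> \<le> 2" using abs_resid_le[OF y] a b by (auto simp: r_def)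
  have A: "\<bar>\<Sum>i=1..n. \<Sum>j=1..n. (c i j - c' i j) * r i j\<bar> \<le> 4 * (\<bar>R a\<bar> + \<bar>R b\<bar>) + 16 + 8 * (\<bar>S\<bar> / n)"
  proof -
    have *: "\<bar>4 * (p + q) - 4 * (v + w) - z\<bar> \<le> 4 * (\<bar>p\<bar> + \<bar>q\<bar>) + 16 + \<bar>z\<bar>"
      if "\<bar>v\<bar> \<le> 2" "\<bar>w\<bar> \<le> 2" for p q v w z :: real
      using that by (smt (verit))
    show ?thesis unfolding 1 abs_mult s using *[OF rb, of "R a" "R b" "8 / n * S"] by (simp add: abs_mult)
  qed
  define h where "h = 2 * \<theta> / (real n - 1)"
  have h: "h \<ge> 0" "h * n \<le> 4 * \<theta>"
  proof -
    show "h \<ge> 0" using n \<theta> by (simp add: h_def)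
    have "h * n = 2 * \<theta> * (n / (real n - 1))" by (simp add: h_def)
    also have "\<dots> \<le> 2 * \<theta> * 2" using n_frac_le[OF y a b ab] \<theta> by (intro mult_left_mono) auto
    finally show "h * n \<le> 4 * \<theta>" by simp
  qed
  have c'b: "\<bar>c' i j\<bar> \<le> \<bar>d i\<bar> + \<bar>d j\<bar> + 14" if "i \<in> {1..n}" "j \<in> {1..n}" for i j
  proof -
    have "\<bar>c i j\<bar> \<le> \<bar>d i\<bar> + \<bar>d j\<bar> + 2" using abs_coef_le[OF y that] by (simp add: c_def d_def)
    moreover have "\<bar>c i j - c' i j\<bar> \<le> 12"
    proof -
      have "\<bar>2 * inc a b i + 2 * inc a b j - 4 * same_edge a b i j\<bar> \<le> 4"
        using ab by (auto simp: inc_def same_edge_def)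
      moreover have "0 \<le> 8 / real n" "8 / real n \<le> 4" using n by (auto simp: field_simps)
      ultimately show ?thesis unfolding dc abs_mult s by (smt (verit))
    qed
    ultimately show ?thesis by linarith
  qed
  have B: "\<bar>\<Sum>i=1..n. \<Sum>j=1..n. c' i j * (r i j - r' i j)\<bar> \<le>
     4 * (\<bar>d a\<bar> + \<bar>d b\<bar> + 14) + 8 * \<theta> * (\<bar>d a\<bar> + \<bar>d b\<bar> + 2 * (D / n) + 28)"
  proof -
    define w where "w i j = \<bar>d i\<bar> + \<bar>d j\<bar> + 14" for i j
    have "\<bar>\<Sum>i=1..n. \<Sum>j=1..n. c' i j * (r i j - r' i j)\<bar> \<le>
      (\<Sum>i=1..n. \<Sum>j=1..n. w i j * (2 * same_edge a b i j + h * (inc a b i + inc a b j)))"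
    proof (intro order_trans[OF sum_abs] sum_mono)
      fix i j assume ij: "i \<in> {1..n}" "j \<in> {1..n}"
      have "w i j \<ge> 0" by (simp add: w_def)
      then show "\<bar>c' i j * (r i j - r' i j)\<bar> \<le> w i j * (2 * same_edge a b i j + h * (inc a b i + inc a b j))"
        unfolding abs_mult h_def w_def using c'b[OF ij] abs_resid_flip_le[OF y a b ab \<theta>]
        by (intro mult_mono) (auto simp: r_def r'_def y'_def)
    qed
    also have "\<dots> = 2 * (\<Sum>i=1..n. \<Sum>j=1..n. same_edge a b i j * w i j)
       + h * ((\<Sum>i=1..n. \<Sum>j=1..n. inc a b i * w i j) + (\<Sum>i=1..n. \<Sum>j=1..n. inc a b j * w i j))"
      by (simp add: algebra_simps sum.distrib sum_distrib_left)
    also have "(\<Sum>i=1..n. \<Sum>j=1..n. same_edge a b i j * w i j) = 2 * w a b"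
      unfolding sum_same_edge_mult[OF a b] by (simp add: w_def)
    also have "(\<Sum>i=1..n. \<Sum>j=1..n. inc a b j * w i j) = (\<Sum>i=1..n. \<Sum>j=1..n. inc a b i * w i j)"
      by (subst sum.swap) (simp add: w_def algebra_simps)
    also have "(\<Sum>i=1..n. \<Sum>j=1..n. inc a b i * w i j) = n * (\<bar>d a\<bar> + \<bar>d b\<bar> + 28) + 2 * D"
      unfolding sum_distrib_left[symmetric] sum_inc_mult[OF a b] w_def D_def
      by (simp add: sum.distrib algebra_simps)
    also have "h * ((n * (\<bar>d a\<bar> + \<bar>d b\<bar> + 28) + 2 * D) + (n * (\<bar>d a\<bar> + \<bar>d b\<bar> + 28) + 2 * D))
        = h * n * (2 * (\<bar>d a\<bar> + \<bar>d b\<bar> + 2 * (D / n) + 28))"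
      using n by (simp add: field_simps)
    also have "\<dots> \<le> 4 * \<theta> * (2 * (\<bar>d a\<bar> + \<bar>d b\<bar> + 2 * (D / n) + 28))"
      using h D by (intro mult_right_mono) auto
    finally show ?thesis by (simp add: w_def algebra_simps)
  qed
  have "centred_score \<theta> \<beta> n y - centred_score \<theta> \<beta> n (flip a b y) =
      (\<Sum>i=1..n. \<Sum>j=1..n. (c i j - c' i j) * r i j) + (\<Sum>i=1..n. \<Sum>j=1..n. c' i j * (r i j - r' i j))"
    unfolding centred_score_def sum.distrib[symmetric] sum_subtractf[symmetric]
    by (intro sum.cong refl) (simp add: c_def c'_def r_def r'_def y'_def algebra_simps)
  then have "\<bar>centred_score \<theta> \<beta> n y - centred_score \<theta> \<beta> n (flip a b y)\<bar> \<le>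
    (4 * (\<bar>R a\<bar> + \<bar>R b\<bar>) + 16 + 8 * (\<bar>S\<bar> / n)) +
     (4 * (\<bar>d a\<bar> + \<bar>d b\<bar> + 14) + 8 * \<theta> * (\<bar>d a\<bar> + \<bar>d b\<bar> + 2 * (D / n) + 28))"
    by (metis order_trans[OF abs_triangle_ineq add_mono[OF A B]])
  \<comment> \<open>\<open>72 = 16 + 4 * 14\<close> and \<open>224 = 8 * 28\<close> are the
    coefficients of the constant term; they dominate all others.\<close>
  also have "\<dots> \<le> (72 + 224 * \<theta>) * (1 + \<bar>R a\<bar> + \<bar>R b\<bar> + \<bar>S\<bar> / n + \<bar>d a\<bar> + \<bar>d b\<bar> + D / n)"
  proof -
    have *: "(4 * (p + q) + 16 + 8 * s) + (4 * (u + v + 14) + 8 * \<theta> * (u + v + 2 * w + 28))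
        \<le> (72 + 224 * \<theta>) * (1 + p + q + s + u + v + w)"
      if "p \<ge> 0" "q \<ge> 0" "s \<ge> 0" "u \<ge> 0" "v \<ge> 0" "w \<ge> 0" for p q s u v w :: real
    proof -
      have "\<theta> * (8 * (u + v + 2 * w + 28)) \<le> \<theta> * (224 * (1 + p + q + s + u + v + w))"
        using that by (intro mult_left_mono \<theta>) simp
      moreover have "(4 * (p + q) + 16 + 8 * s) + 4 * (u + v + 14) \<le> 72 * (1 + p + q + s + u + v + w)"
        using that by simp
      moreover have "8 * \<theta> * (u + v + 2 * w + 28) = \<theta> * (8 * (u + v + 2 * w + 28))"
        "(72 + 224 * \<theta>) * (1 + p + q + s + u + v + w) =
          72 * (1 + p + q + s + u + v + w) + \<theta> * (224 * (1 + p + q + s + u + v + w))"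
        by (simp_all only: distrib_right mult.assoc mult.left_commute)
      ultimately show ?thesis by linarith
    qed
    show ?thesis by (rule *) (use D in auto)
  qed
  finally show ?thesis by (simp add: S_def D_def)
qed

end

section \<open>Detailed balance and second moments\<close>

definition spin :: "nat \<Rightarrow> adjacency \<Rightarrow> nat \<Rightarrow> nat \<Rightarrow> real" where
  "spin n g i j = (if i \<in> {1..n} \<and> j \<in> {1..n} \<and> i \<noteq> j then 2 * real (g i j) - 1 else 0)"

definition toggle :: "nat \<Rightarrow> nat \<Rightarrow> adjacency \<Rightarrow> adjacency" where
  "toggle a b g = (\<lambda>i j. if (i = a \<and> j = b) \<or> (i = b \<and> j = a) then 1 - g i j else g i j)"

lemma graphs_01: "g \<in> graphs n \<Longrightarrow> g i j = 0 \<or> g i j = 1"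
  unfolding graphs_def by auto

lemma graphs_sym: "g \<in> graphs n \<Longrightarrow> g i j = g j i"
  unfolding graphs_def by auto

lemma spins_spin: "g \<in> graphs n \<Longrightarrow> spins n (spin n g)"
  using graphs_01[of g n] graphs_sym[of g n] unfolding spins_def spin_def by force

lemma toggle_graphs:
  "g \<in> graphs n \<Longrightarrow> a \<in> {1..n} \<Longrightarrow> b \<in> {1..n} \<Longrightarrow> a \<noteq> b \<Longrightarrow> toggle a b g \<in> graphs n"
  unfolding graphs_def toggle_def by auto

text \<open>Subtraction on the naturals is truncated, so the involution depends on the entries being
  0 or 1.\<close>

lemma toggle_toggle:
  assumes "g \<in> graphs n"
  shows "toggle a b (toggle a b g) = g"
proof (intro ext)
  fix i j
  have "1 - (1 - g i j) = g i j"
    using graphs_01[OF assms, of i j] by linarith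
  then show "toggle a b (toggle a b g) i j = g i j"
    unfolding toggle_def by presburger
qed

lemma spin_toggle:
  "g \<in> graphs n \<Longrightarrow> a \<in> {1..n} \<Longrightarrow> b \<in> {1..n} \<Longrightarrow> a \<noteq> b \<Longrightarrow> spin n (toggle a b g) = flip a b (spin n g)"
  by (rule ext)+ (use graphs_01[of g n a b] graphs_01[of g n b a] in \<open>auto simp: spin_def toggle_def flip_def\<close>)

text \<open>The handshake lemma. The summation range \<open>m\<close> is separate from the vertex
  number \<open>n\<close> so that the induction runs over \<open>m\<close> for a fixed
  graph.\<close>

lemma sum_degrees:
  assumes "g \<in> graphs n"
  shows "(\<Sum>i=1..m. \<Sum>j=1..m. g i j) = 2 * num_edges m g"
proof (induction m)
  case (Suc m)
  have d: "g (Suc m) (Suc m) = 0" using assms by (auto simp: graphs_def)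
  have "(\<Sum>i=1..m. g i (Suc m)) = (\<Sum>i=1..m. g (Suc m) i)"
    using graphs_sym[OF assms] by simp
  moreover have "num_edges (Suc m) g = num_edges m g + (\<Sum>i=1..m. g i (Suc m))"
    unfolding num_edges_def by (simp add: atLeastLessThanSuc_atLeastAtMost)
  ultimately show ?case using Suc d by (simp add: sum.distrib)
qed (simp add: num_edges_def)

text \<open>The log-density up to an additive constant depending only on \<open>n\<close> and the parameters.\<close>

definition log_weight :: "real \<Rightarrow> real \<Rightarrow> nat \<Rightarrow> (nat \<Rightarrow> nat \<Rightarrow> real) \<Rightarrow> real" where
  "log_weight \<theta> \<beta> n y =
     \<theta> / (2 * (real n - 1)) * (\<Sum>i=1..n. (rowsum n y i)\<^sup>2) + \<beta> / 2 * (\<Sum>i=1..n. rowsum n y i)"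

lemma real_choose_2: "real (m choose 2) = (real m ^ 2 - real m) / 2"
  by (induction m) (auto simp: numeral_2_eq_2 power2_eq_square field_simps)

text \<open>The extra edge weight \<omega>1/(n - 1) of the model cancels the linear part of the
  binomial coefficient, so each vertex contributes a multiple of its squared degree and a linear
  term. Substituting \<open>(k i + N) / 2\<close> for the degree gives the Ising form; the prefactor
  cancels in ratios of weights.\<close>

lemma two_star_weight_eq:
  assumes g: "g \<in> graphs n" and n: "n \<ge> 2"
  shows "two_star_weight (4 * \<theta>) (2 * \<beta> - 4 * \<theta>) n g =
     exp (real n * (real n - 1) * (\<beta> - \<theta>) / 2) * exp (log_weight \<theta> \<beta> n (spin n g))"
proof -
  define N where "N = real n - 1"
  have N: "N > 0" using n by (simp add: N_def)
  define k where "k = rowsum n (spin n g)"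
  have deg: "real (vdegree n g i) = (k i + N) / 2" if i: "i \<in> {1..n}" for i
  proof -
    have "spin n g i j = 2 * real (g i j) - 1 + of_bool (j = i)" if "j \<in> {1..n}" for j
      using that i g by (auto simp: spin_def graphs_def)
    then have "k i = (\<Sum>j=1..n. 2 * real (g i j) - 1 + of_bool (j = i))"
      unfolding k_def rowsum_def by (intro sum.cong) auto
    also have "\<dots> = 2 * real (vdegree n g i) - real n + 1"
      using i by (simp add: vdegree_def sum.distrib sum_subtractf sum_distrib_left)
    finally show ?thesis by (simp add: N_def)
  qed
  have "2 * real (num_edges n g) = (\<Sum>i=1..n. real (vdegree n g i))"
    using arg_cong[OF sum_degrees[OF g, of n], of real] by (simp add: vdegree_def)
  then have E: "real (num_edges n g) = (\<Sum>i=1..n. real (vdegree n g i) / 2)"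
    by (simp add: sum_divide_distrib[symmetric])
  have "(2 * \<beta> - 4 * \<theta> + 4 * \<theta> / N) * real (num_edges n g) + 4 * \<theta> / N * real (num_two_stars n g)
     = (\<Sum>i=1..n. (2 * \<beta> - 4 * \<theta> + 4 * \<theta> / N) * (real (vdegree n g i) / 2)
         + 4 * \<theta> / N * ((real (vdegree n g i) ^ 2 - real (vdegree n g i)) / 2))"
    by (simp add: E num_two_stars_def real_choose_2 sum.distrib sum_distrib_left)
  also have "\<dots> = (\<Sum>i=1..n. N * (\<beta> - \<theta>) / 2 + \<theta> / (2 * N) * (k i)\<^sup>2 + \<beta> / 2 * k i)"
    using N by (intro sum.cong refl) (simp add: deg power2_eq_square field_simps)
  also have "\<dots> = real n * N * (\<beta> - \<theta>) / 2 + log_weight \<theta> \<beta> n (spin n g)"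
    by (simp add: log_weight_def k_def N_def sum.distrib sum_distrib_left)
  finally show ?thesis
    unfolding two_star_weight_def N_def by (simp add: exp_add)
qed

lemma log_weight_flip:
  assumes y: "spins n y" and a: "a \<in> {1..n}" and b: "b \<in> {1..n}" and ab: "a \<noteq> b"
  shows "log_weight \<theta> \<beta> n (flip a b y) = log_weight \<theta> \<beta> n y - 2 * y a b * (\<beta> + \<theta> * field n y a b)"
proof -
  define s k where "s = y a b" and "k = rowsum n y"
  have s: "s * s = 1" using spins_square[OF y a b ab] by (simp add: s_def power2_eq_square)
  define N where "N = real n - 1"
  have N: "N > 0" using n_ge_2[OF y a b ab] by (simp add: N_def)
  have sq: "(rowsum n (flip a b y) i)\<^sup>2 = (k i)\<^sup>2 - 4 * s * (inc a b i * k i) + 4 * inc a b i" for i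
  proof -
    have "inc a b i * inc a b i = inc a b i" using ab by (auto simp: inc_def)
    moreover have "(rowsum n (flip a b y) i)\<^sup>2 = (k i)\<^sup>2 - 4 * s * (inc a b i * k i) + 4 * ((s * s) * (inc a b i * inc a b i))"
      unfolding rowsum_flip[OF y a b ab] s_def k_def by (simp add: power2_eq_square algebra_simps)
    ultimately show ?thesis unfolding s by simp
  qed
  \<comment> \<open>The square \<open>s * s = 1\<close> is left unevaluated here: it supplies the
    term \<open>- 2 * y a b\<close> by which the field excludes its own spin.\<close>
  have 1: "(\<Sum>i=1..n. (rowsum n (flip a b y) i)\<^sup>2) = (\<Sum>i=1..n. (k i)\<^sup>2) - 4 * s * (k a + k b) + 8 * (s * s)"
    unfolding sq s using sum_inc_mult[OF a b, of k]
    by (simp add: sum.distrib sum_subtractf sum_distrib_left[symmetric] sum_inc[OF a b])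
  have 2: "(\<Sum>i=1..n. rowsum n (flip a b y) i) = (\<Sum>i=1..n. k i) - 4 * s"
    unfolding rowsum_flip[OF y a b ab] s_def k_def
    by (simp add: sum_subtractf sum_distrib_left[symmetric] sum_inc[OF a b])
  show ?thesis
    unfolding log_weight_def field_def 1 2 N_def[symmetric] s_def[symmetric] k_def[symmetric] using N
    by (simp add: field_simps)
qed

text \<open>Given the other edges, a spin has weights proportional to \<open>exp (s * x)\<close> for
  its two values, hence mean \<open>tanh x\<close>. The identity says that the residual has
  conditional mean 0, with the weight of the current value scaled to 1.\<close>

lemma tanh_detailed_balance:
  fixes s x :: real
  assumes "s = 1 \<or> s = -1"
  shows "(s - tanh x) + exp (- 2 * s * x) * (- s - tanh x) = 0"
proof -
  define q where "q = exp (- 2 * x)"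
  have q: "q > 0" by (simp add: q_def)
  have t: "tanh x = (1 - q) / (1 + q)" by (simp add: tanh_real_altdef q_def)
  have e: "exp (- (2 * x)) = q" "exp (2 * x) = 1 / q" by (simp_all add: q_def exp_minus divide_inverse)
  have t': "1 - tanh x = 2 * q / (1 + q)" "1 + tanh x = 2 / (1 + q)"
    using q by (simp_all add: t field_simps)
  show ?thesis using assms
  proof
    assume s: "s = 1"
    have "exp (- 2 * s * x) = q" by (simp add: s e)
    then have "(s - tanh x) + exp (- 2 * s * x) * (- s - tanh x) = (1 - tanh x) - q * (1 + tanh x)"
      by (simp add: s algebra_simps)
    then show ?thesis unfolding t' by simp
  next
    assume s: "s = -1"
    have "exp (- 2 * s * x) = 1 / q" by (simp add: s e)
    then have "(s - tanh x) + exp (- 2 * s * x) * (- s - tanh x) = (1 / q) * (1 - tanh x) - (1 + tanh x)"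
      by (simp add: s algebra_simps)
    then show ?thesis unfolding t' using q by simp
  qed
qed

section \<open>Expectations and the flip identity\<close>

text \<open>A finite sum over graphs instead of an integral, so linearity and monotonicity come
  without integrability conditions.\<close>

definition expect :: "real \<Rightarrow> real \<Rightarrow> nat \<Rightarrow> ((nat \<Rightarrow> nat \<Rightarrow> real) \<Rightarrow> real) \<Rightarrow> real" where
  "expect \<theta> \<beta> n F = (\<Sum>g\<in>graphs n. pmf (two_star \<theta> \<beta> n) g * F (spin n g))"

lemma expect_mono: "(\<And>y. spins n y \<Longrightarrow> F y \<le> G y) \<Longrightarrow> expect \<theta> \<beta> n F \<le> expect \<theta> \<beta> n G"
  unfolding expect_def by (intro sum_mono mult_left_mono) (auto intro: spins_spin)

lemma expect_cong: "(\<And>y. spins n y \<Longrightarrow> F y = G y) \<Longrightarrow> expect \<theta> \<beta> n F = expect \<theta> \<beta> n G"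
  unfolding expect_def by (intro sum.cong) (auto simp: spins_spin)

lemma expect_add: "expect \<theta> \<beta> n (\<lambda>y. F y + G y) = expect \<theta> \<beta> n F + expect \<theta> \<beta> n G"
  by (simp add: expect_def distrib_left sum.distrib)

lemma expect_cmult: "expect \<theta> \<beta> n (\<lambda>y. c * F y) = c * expect \<theta> \<beta> n F"
  by (simp add: expect_def sum_distrib_left mult.left_commute)

lemma expect_sum: "expect \<theta> \<beta> n (\<lambda>y. \<Sum>i\<in>A. F i y) = (\<Sum>i\<in>A. expect \<theta> \<beta> n (F i))"
  unfolding expect_def sum_distrib_left by (rule sum.swap)

lemma set_pmf_two_star: "set_pmf (two_star \<theta> \<beta> n) \<subseteq> graphs n"
  by (auto simp: two_star_def set_pmf_iff pmf_two_star_pmf split: if_splits)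

lemma expect_const: "expect \<theta> \<beta> n (\<lambda>_. c) = c"
  unfolding expect_def using sum_pmf_eq_1[OF finite_graphs set_pmf_two_star]
  by (simp add: sum_distrib_right[symmetric])

lemma prob_le_expect:
  assumes "\<And>y. spins n y \<Longrightarrow> 0 \<le> F y" and "K > 0"
  shows "measure_pmf.prob (two_star \<theta> \<beta> n) {g. K \<le> F (spin n g)} \<le> expect \<theta> \<beta> n F / K"
proof -
  let ?p = "two_star \<theta> \<beta> n" and ?A = "{g. K \<le> F (spin n g)}"
  have "measure_pmf.prob ?p ?A = measure_pmf.prob ?p (?A \<inter> graphs n)"
    using set_pmf_two_star[of \<theta> \<beta> n] by (intro measure_prob_cong_0) (auto simp: set_pmf_iff)
  also have "\<dots> = (\<Sum>g\<in>?A \<inter> graphs n. pmf ?p g)"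
    by (intro measure_measure_pmf_finite) (simp add: finite_graphs)
  also have "\<dots> \<le> (\<Sum>g\<in>?A \<inter> graphs n. pmf ?p g * (F (spin n g) / K))"
    using assms(2) by (intro sum_mono) (auto simp: field_simps intro!: mult_right_mono)
  also have "\<dots> \<le> (\<Sum>g\<in>graphs n. pmf ?p g * (F (spin n g) / K))"
    using assms by (intro sum_mono2 finite_graphs) (auto simp: spins_spin)
  also have "\<dots> = expect \<theta> \<beta> n F / K"
    by (simp add: expect_def sum_divide_distrib)
  finally show ?thesis .
qed

lemma expect_resid:
  assumes a: "a \<in> {1..n}" and b: "b \<in> {1..n}" and ab: "a \<noteq> b"
  shows "expect \<theta> \<beta> n (\<lambda>y. resid \<theta> \<beta> n y a b * F y) =
     expect \<theta> \<beta> n (\<lambda>y. resid \<theta> \<beta> n y a b * (F y - F (flip a b y))) / 2"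
proof -
  let ?p = "pmf (two_star \<theta> \<beta> n)" and ?r = "\<lambda>y. resid \<theta> \<beta> n y a b"
  have n: "n \<ge> 2" using assms by auto
  have bal: "?p (toggle a b g) * ?r (flip a b (spin n g)) = - (?p g * ?r (spin n g))"
    if g: "g \<in> graphs n" for g
  proof -
    let ?y = "spin n g"
    define s x where "s = ?y a b" and "x = \<beta> + \<theta> * field n ?y a b"
    have y: "spins n ?y" using spins_spin[OF g] .
    have s: "s = 1 \<or> s = -1" using y assms unfolding spins_def s_def by blast
    have p: "?p (toggle a b g) = ?p g * exp (- 2 * s * x)"
      unfolding two_star_def pmf_two_star_pmf two_star_weight_eq[OF g n]
        two_star_weight_eq[OF toggle_graphs[OF g assms] n] spin_toggle[OF g assms]
        log_weight_flip[OF y assms] s_def[symmetric] x_def[symmetric]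
      using g toggle_graphs[OF g assms] exp_add[of "log_weight \<theta> \<beta> n ?y" "- 2 * s * x"] by simp
    \<comment> \<open>At its own edge the increment \<open>inc + inc - 2 * same_edge\<close> is
      \<open>1 + 1 - 2 = 0\<close>, so both values of the spin are compared with the same
      conditional mean.\<close>
    have "field n (flip a b ?y) a b = field n ?y a b"
      unfolding field_flip[OF y assms] using ab by (simp add: inc_def same_edge_def)
    then have r: "?r (flip a b ?y) = - s - tanh x" "?r ?y = s - tanh x"
      using ab by (simp_all add: resid_def x_def s_def flip_def)
    have e: "exp (- 2 * s * x) * (- s - tanh x) = - (s - tanh x)"
      using tanh_detailed_balance[OF s, of x] by linarith
    have "?p g * exp (- 2 * s * x) * (- s - tanh x) = ?p g * (exp (- 2 * s * x) * (- s - tanh x))"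
      by (rule mult.assoc)
    then show ?thesis unfolding p r by (simp only: e mult_minus_right)
  qed
  \<comment> \<open>Substitute the toggled graph, which moves the flip from \<open>F\<close> to the
    weight and the residual, where it is a change of sign.\<close>
  have "(\<Sum>g\<in>graphs n. ?p g * (?r (spin n g) * F (flip a b (spin n g))))
     = (\<Sum>g\<in>graphs n. ?p (toggle a b g) * (?r (flip a b (spin n g)) * F (spin n g)))"
    using assms
    by (intro sum.reindex_bij_witness[where i = "toggle a b" and j = "toggle a b"])
       (auto simp: toggle_graphs toggle_toggle spin_toggle[symmetric])
  also have "\<dots> = (\<Sum>g\<in>graphs n. - (?p g * ?r (spin n g)) * F (spin n g))"
    using bal by (intro sum.cong refl) (simp only: mult.assoc[symmetric])
  finally have "expect \<theta> \<beta> n (\<lambda>y. ?r y * F (flip a b y)) = - expect \<theta> \<beta> n (\<lambda>y. ?r y * F y)"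
    by (simp add: expect_def sum_negf mult.assoc)
  moreover have "expect \<theta> \<beta> n (\<lambda>y. ?r y * (F y - F (flip a b y))) =
      expect \<theta> \<beta> n (\<lambda>y. ?r y * F y) - expect \<theta> \<beta> n (\<lambda>y. ?r y * F (flip a b y))"
    by (simp add: expect_def right_diff_distrib sum_subtractf)
  ultimately show ?thesis by simp
qed

text \<open>The bound 2 on a residual cancels the factor 1/2 of the flip identity. The case of equal
  indices is included, the residual being 0 there, so that full double sums can be treated.\<close>

lemma expect_resid_le:
  assumes "a \<in> {1..n}" "b \<in> {1..n}"
    and "\<And>y. spins n y \<Longrightarrow> 0 \<le> B y"
    and "\<And>y. spins n y \<Longrightarrow> a \<noteq> b \<Longrightarrow> \<bar>F y - F (flip a b y)\<bar> \<le> B y"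
  shows "expect \<theta> \<beta> n (\<lambda>y. resid \<theta> \<beta> n y a b * F y) \<le> expect \<theta> \<beta> n B"
proof (cases "a = b")
  case True
  then show ?thesis using assms(3) expect_mono[of n "\<lambda>_. 0" B \<theta> \<beta>]
    by (simp add: resid_def expect_def)
next
  case False
  have "expect \<theta> \<beta> n (\<lambda>y. resid \<theta> \<beta> n y a b * (F y - F (flip a b y))) \<le> expect \<theta> \<beta> n (\<lambda>y. 2 * B y)"
  proof (rule expect_mono)
    fix y assume y: "spins n y"
    have "\<bar>resid \<theta> \<beta> n y a b * (F y - F (flip a b y))\<bar> \<le> 2 * B y"
      unfolding abs_mult using abs_resid_le[OF y assms(1,2)] assms(4)[OF y False] by (intro mult_mono) auto
    then show "resid \<theta> \<beta> n y a b * (F y - F (flip a b y)) \<le> 2 * B y" by linarith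
  qed
  then show ?thesis using expect_resid[OF assms(1,2) False, of \<theta> \<beta> F] by (simp add: expect_cmult)
qed

text \<open>Only one factor of the square is expanded; the other, kept whole, changes by a bounded
  amount under a flip. The result has the order of a sum of independent residuals.\<close>

lemma expect_row_resid_sq_le:
  assumes "\<theta> \<ge> 0" "i \<in> {1..n}"
  shows "expect \<theta> \<beta> n (\<lambda>y. (row_resid \<theta> \<beta> n y i)\<^sup>2) \<le> (2 + 8 * \<theta>) * n"
proof -
  have "expect \<theta> \<beta> n (\<lambda>y. (row_resid \<theta> \<beta> n y i)\<^sup>2) =
     (\<Sum>j=1..n. expect \<theta> \<beta> n (\<lambda>y. resid \<theta> \<beta> n y i j * row_resid \<theta> \<beta> n y i))"
    unfolding expect_sum[symmetric] by (simp add: power2_eq_square row_resid_def sum_distrib_right)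
  also have "\<dots> \<le> (\<Sum>j=1..n. expect \<theta> \<beta> n (\<lambda>_. 2 + 8 * \<theta>))"
    using assms by (intro sum_mono expect_resid_le abs_row_resid_flip_le) auto
  finally show ?thesis by (simp add: expect_const mult.commute)
qed

lemma expect_score_sq_le:
  assumes "\<theta> \<ge> 0"
  shows "expect \<theta> \<beta> n (\<lambda>y. (score \<theta> \<beta> n y)\<^sup>2) \<le> (4 + 16 * \<theta>) * (real n)\<^sup>2"
proof -
  have "expect \<theta> \<beta> n (\<lambda>y. (score \<theta> \<beta> n y)\<^sup>2) =
     (\<Sum>i=1..n. \<Sum>j=1..n. expect \<theta> \<beta> n (\<lambda>y. resid \<theta> \<beta> n y i j * score \<theta> \<beta> n y))"
    unfolding expect_sum[symmetric]
    by (simp add: power2_eq_square score_def row_resid_def sum_distrib_right)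
  also have "\<dots> \<le> (\<Sum>i=1..n. \<Sum>j=1..n. expect \<theta> \<beta> n (\<lambda>_. 4 + 16 * \<theta>))"
    using assms by (intro sum_mono expect_resid_le abs_score_flip_le) auto
  finally show ?thesis by (simp add: expect_const mult.commute power2_eq_square algebra_simps)
qed

section \<open>Self-normalised second moment of the centred score\<close>

text \<open>Up to a factor n, the inverse of the natural variance of the centred score. The summand
  \<open>n^2\<close> limits its relative change under a flip.\<close>

definition precision :: "nat \<Rightarrow> (nat \<Rightarrow> nat \<Rightarrow> real) \<Rightarrow> real" where
  "precision n y = 1 / (dispersion n y + (real n)\<^sup>2)"

lemma precision_pos: "spins n y \<Longrightarrow> n \<ge> 1 \<Longrightarrow> precision n y > 0"
  using dispersion_nonneg[of n y] unfolding precision_def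
  by (intro divide_pos_pos add_nonneg_pos) auto

lemma precision_mult: "spins n y \<Longrightarrow> n \<ge> 1 \<Longrightarrow> precision n y * (dispersion n y + (real n)\<^sup>2) = 1"
  using precision_pos[of n y] unfolding precision_def by simp

context
  fixes n :: nat and y :: "nat \<Rightarrow> nat \<Rightarrow> real" and a b :: nat
  assumes y: "spins n y" and a: "a \<in> {1..n}" and b: "b \<in> {1..n}" and ab: "a \<noteq> b"
begin

lemma precision_flip:
  shows precision_flip_le: "precision n (flip a b y) \<le> 11 * precision n y"
    and abs_precision_flip_le: "\<bar>precision n y - precision n (flip a b y)\<bar> \<le>
      4 * (\<bar>dev n y a\<bar> + \<bar>dev n y b\<bar> + 2) / (real n)\<^sup>2 * precision n y"
proof -
  define V V' N w where "V = dispersion n y" and "V' = dispersion n (flip a b y)" and "N = (real n)\<^sup>2"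
    and "w = \<bar>dev n y a\<bar> + \<bar>dev n y b\<bar> + 2"
  have n: "real n \<ge> 2" using n_ge_2[OF y a b ab] by simp
  have nonneg: "V \<ge> 0" "V' \<ge> 0" "w \<ge> 0"
    using dispersion_nonneg[OF y] dispersion_nonneg[OF spins_flip[OF y]] by (auto simp: V_def V'_def w_def)
  have "2 * real n \<le> real n * real n" using n by (intro mult_right_mono) auto
  then have N: "2 * real n \<le> N" by (simp add: N_def power2_eq_square)
  then have N0: "N > 0" using n by linarith
  have d: "\<bar>V - V'\<bar> \<le> 4 * w" using abs_dispersion_flip_le[OF y a b ab] by (simp add: V_def V'_def w_def)
  have "w \<le> 4 * real n + 2" using abs_dev_le[OF y a] abs_dev_le[OF y b] by (simp add: w_def)
  moreover have "V \<le> V' + 4 * w" using d by (simp add: abs_le_iff)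
  \<comment> \<open>\<open>4 * w \<le> 16 * n + 8\<close>, where \<open>16 * n \<le> 8 * N\<close>
    and \<open>8 \<le> 4 * n \<le> 2 * N\<close>; with N itself this makes 11.\<close>
  ultimately have "V + N \<le> 11 * V' + 11 * N" using nonneg(2) N n by linarith
  then have "V' + N > 0" "V + N > 0" "V + N \<le> 11 * (V' + N)" using nonneg N0 by auto
  then show "precision n (flip a b y) \<le> 11 * precision n y"
    unfolding precision_def V_def[symmetric] V'_def[symmetric] N_def[symmetric]
    by (simp add: field_simps)
  have "precision n y - precision n (flip a b y) = (V' - V) / ((V' + N) * (V + N))"
    unfolding precision_def V_def[symmetric] V'_def[symmetric] N_def[symmetric]
    using N0 nonneg by (simp add: field_simps)
  also have "\<bar>\<dots>\<bar> = \<bar>V - V'\<bar> / ((V' + N) * (V + N))"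
    using N0 nonneg by (simp add: abs_divide abs_mult abs_minus_commute)
  also have "\<dots> \<le> 4 * w / (N * (V + N))"
    using N0 nonneg d by (intro frac_le mult_right_mono) auto
  also have "\<dots> = 4 * w / N * precision n y"
    unfolding precision_def V_def[symmetric] N_def[symmetric] by simp
  finally show "\<bar>precision n y - precision n (flip a b y)\<bar> \<le>
      4 * (\<bar>dev n y a\<bar> + \<bar>dev n y b\<bar> + 2) / (real n)\<^sup>2 * precision n y"
    by (simp add: w_def N_def)
qed

text \<open>A product rule for coefficient, normaliser and score, with every normaliser referred
  back to the unflipped configuration. The constants are \<open>33 = 3 * 11\<close> and
  \<open>88 = 8 * 11\<close>, with 11 from \<open>precision_flip_le\<close>.\<close>

lemma abs_weighted_centred_score_flip_le:
  fixes \<theta> \<beta> :: real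
  defines "w \<equiv> \<bar>dev n y a\<bar> + \<bar>dev n y b\<bar> + 2"
    and "F \<equiv> \<lambda>z. coef n z a b * (precision n z * centred_score \<theta> \<beta> n z)"
  shows "\<bar>F y - F (flip a b y)\<bar> \<le> precision n y *
    (33 * w * \<bar>centred_score \<theta> \<beta> n y - centred_score \<theta> \<beta> n (flip a b y)\<bar> +
      (88 / n + 4 * w\<^sup>2 / (real n)\<^sup>2) * \<bar>centred_score \<theta> \<beta> n y\<bar>)"
proof -
  define c c' p p' Q Q' where "c = coef n y a b" and "c' = coef n (flip a b y) a b"
    and "p = precision n y" and "p' = precision n (flip a b y)"
    and "Q = centred_score \<theta> \<beta> n y" and "Q' = centred_score \<theta> \<beta> n (flip a b y)"
  have n: "real n \<ge> 2" using n_ge_2[OF y a b ab] by simp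
  have p: "p > 0" "p' > 0" using precision_pos y spins_flip[OF y] n by (auto simp: p_def p'_def)
  have p': "p' \<le> 11 * p" using precision_flip_le by (simp add: p_def p'_def)
  have w: "w \<ge> 2" by (simp add: w_def)
  have c: "\<bar>c\<bar> \<le> w" using abs_coef_le[OF y a b] by (simp add: c_def w_def)
  \<comment> \<open>The coefficient of an edge excludes its own spin, so only the recentring by
    \<open>avg\<close> is felt.\<close>
  have "c - c' = - (8 * y a b / n)"
    unfolding c_def c'_def coef_flip[OF y a b ab] using ab by (simp add: inc_def same_edge_def)
  then have dc: "\<bar>c - c'\<bar> = 8 / n" using spins_abs[OF y a b ab] by (simp add: abs_mult)
  have "8 / real n \<le> 4" using n by (simp add: field_simps)
  then have c': "\<bar>c'\<bar> \<le> 3 * w" using dc c w by (smt (verit))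
  have "\<bar>c * p - c' * p'\<bar> = \<bar>c * (p - p') + (c - c') * p'\<bar>" by (simp add: algebra_simps)
  also have "\<dots> \<le> \<bar>c\<bar> * \<bar>p - p'\<bar> + \<bar>c - c'\<bar> * p'"
    using p abs_triangle_ineq[of "c * (p - p')" "(c - c') * p'"] by (simp add: abs_mult)
  also have "\<dots> \<le> w * (4 * w / (real n)\<^sup>2 * p) + 8 / n * (11 * p)"
    using c dc p p' w abs_precision_flip_le unfolding p_def[symmetric] p'_def[symmetric] w_def[symmetric]
    by (intro add_mono mult_mono) auto
  also have "\<dots> = p * (88 / n + 4 * w\<^sup>2 / (real n)\<^sup>2)"
    by (simp add: power2_eq_square algebra_simps)
  finally have 1: "\<bar>c * p - c' * p'\<bar> \<le> p * (88 / n + 4 * w\<^sup>2 / (real n)\<^sup>2)" .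
  have "\<bar>c' * p'\<bar> \<le> 3 * w * (11 * p)"
    unfolding abs_mult using c' p p' w by (intro mult_mono) auto
  also have "3 * w * (11 * p) = p * (33 * w)" by simp
  finally have 2: "\<bar>c' * p'\<bar> \<le> p * (33 * w)" .
  have "F y - F (flip a b y) = c' * p' * (Q - Q') + (c * p - c' * p') * Q"
    by (simp add: F_def c_def c'_def p_def p'_def Q_def Q'_def algebra_simps)
  also have "\<bar>\<dots>\<bar> \<le> \<bar>c' * p'\<bar> * \<bar>Q - Q'\<bar> + \<bar>c * p - c' * p'\<bar> * \<bar>Q\<bar>"
    by (rule order_trans[OF abs_triangle_ineq]) (simp add: abs_mult)
  also have "\<dots> \<le> p * (33 * w) * \<bar>Q - Q'\<bar> + p * (88 / n + 4 * w\<^sup>2 / (real n)\<^sup>2) * \<bar>Q\<bar>"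
    using 1 2 by (intro add_mono mult_right_mono) auto
  finally show ?thesis by (simp add: p_def Q_def Q'_def algebra_simps)
qed

end

lemma sum_sq_7: "(x1 + x2 + x3 + x4 + x5 + x6 + x7)\<^sup>2 \<le>
   7 * (x1\<^sup>2 + x2\<^sup>2 + x3\<^sup>2 + x4\<^sup>2 + x5\<^sup>2 + x6\<^sup>2 + x7\<^sup>2)" for x1 :: real
  using sum_squared_le_sum_of_squares[of "(!) [x1, x2, x3, x4, x5, x6, x7]" "{..<7}"]
  by (simp add: eval_nat_numeral lessThan_Suc One_nat_def algebra_simps)

text \<open>Products are split by \<open>w * G \<le> (w^2 + G^2) / 2\<close>. The double sums then
  contain V and \<open>n^2\<close> with factors of order at most n, and \<open>p * V\<close> and
  \<open>p * n^2\<close> are at most 1.\<close>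

lemma weighted_increments_le:
  fixes \<theta> \<beta> :: real
  assumes y: "spins n y" and n: "n \<ge> 1"
  defines "d \<equiv> dev n y" and "R \<equiv> row_resid \<theta> \<beta> n y" and "S \<equiv> score \<theta> \<beta> n y" and "V \<equiv> dispersion n y"
  shows "precision n y * (\<Sum>i=1..n. \<Sum>j=1..n. (\<bar>d i\<bar> + \<bar>d j\<bar> + 2) *
      (1 + \<bar>R i\<bar> + \<bar>R j\<bar> + \<bar>S\<bar> / n + \<bar>d i\<bar> + \<bar>d j\<bar> + (\<Sum>k=1..n. \<bar>d k\<bar>) / n))
    \<le> 17 * n + 7 * (\<Sum>i=1..n. (R i)\<^sup>2) / n + 7 / 2 * S\<^sup>2 / (real n)\<^sup>2"
proof -
  define D where "D = (\<Sum>k=1..n. \<bar>d k\<bar>)"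
  define w G where "w i j = \<bar>d i\<bar> + \<bar>d j\<bar> + 2"
    and "G i j = 1 + \<bar>R i\<bar> + \<bar>R j\<bar> + \<bar>S\<bar> / n + \<bar>d i\<bar> + \<bar>d j\<bar> + D / n" for i j
  define p where "p = precision n y"
  have p0: "p > 0" using precision_pos[OF y n] by (simp add: p_def)
  have V0: "V \<ge> 0" using dispersion_nonneg[OF y] by (simp add: V_def)
  have N: "real n \<ge> 1" using n by simp
  have pN: "p * (V + (real n)\<^sup>2) = 1" using precision_mult[OF y n] by (simp add: p_def V_def)
  have pV: "p * V \<le> 1" and pn: "p * (real n)\<^sup>2 \<le> 1"
    using pN p0 V0 by (simp_all add: distrib_left add_increasing add_increasing2)
      (metis add_increasing2 le_add_same_cancel1 less_imp_le mult_nonneg_nonneg zero_le_power2 add.commute le_add_same_cancel2)+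
  have D2: "D\<^sup>2 \<le> n * V"
    unfolding D_def V_def dispersion_def d_def
    using sum_squared_le_sum_of_squares[of "\<lambda>k. \<bar>dev n y k\<bar>" "{1..n}"] by (simp add: mult.commute)
  have G2: "(G i j)\<^sup>2 \<le> 7 * (1 + (R i)\<^sup>2 + (R j)\<^sup>2 + (S / n)\<^sup>2 + (d i)\<^sup>2 + (d j)\<^sup>2 + (D / n)\<^sup>2)" for i j
    unfolding G_def using sum_sq_7[of 1 "\<bar>R i\<bar>" "\<bar>R j\<bar>" "\<bar>S\<bar> / n" "\<bar>d i\<bar>" "\<bar>d j\<bar>" "D / n"]
    by (simp add: power_divide)
  have "(\<Sum>i=1..n. \<Sum>j=1..n. (G i j)\<^sup>2) \<le> (\<Sum>i=1..n. \<Sum>j=1..n. 7 * (1 + (R i)\<^sup>2 + (R j)\<^sup>2 + (S / n)\<^sup>2 + (d i)\<^sup>2 + (d j)\<^sup>2 + (D / n)\<^sup>2))"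
    by (intro sum_mono G2)
  also have "\<dots> = 7 * ((real n)\<^sup>2 + 2 * n * (\<Sum>i=1..n. (R i)\<^sup>2) + S\<^sup>2 + 2 * n * V + D\<^sup>2)"
    using N unfolding V_def dispersion_def d_def[symmetric]
    by (simp add: sum.distrib flip: sum_distrib_left) (simp add: power2_eq_square field_simps)
  also have "\<dots> \<le> 7 * ((real n)\<^sup>2 + 2 * n * (\<Sum>i=1..n. (R i)\<^sup>2) + S\<^sup>2 + 3 * n * V)"
    using D2 by (simp add: mult.commute)
  finally have SG: "(\<Sum>i=1..n. \<Sum>j=1..n. (G i j)\<^sup>2) \<le> 7 * ((real n)\<^sup>2 + 2 * n * (\<Sum>i=1..n. (R i)\<^sup>2) + S\<^sup>2 + 3 * n * V)" .
  have Sw: "(\<Sum>i=1..n. \<Sum>j=1..n. (w i j)\<^sup>2) \<le> 6 * n * V + 12 * (real n)\<^sup>2"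
    using sum_sq_bound[OF y] by (simp add: w_def d_def V_def)
  have wG: "w i j * G i j \<le> (w i j)\<^sup>2 / 2 + (G i j)\<^sup>2 / 2" for i j
    using zero_le_power2[of "w i j - G i j"] by (simp add: power2_eq_square algebra_simps)
  have "(\<Sum>i=1..n. \<Sum>j=1..n. w i j * G i j) \<le> (\<Sum>i=1..n. \<Sum>j=1..n. (w i j)\<^sup>2 / 2 + (G i j)\<^sup>2 / 2)"
    by (intro sum_mono wG)
  also have "\<dots> = (\<Sum>i=1..n. \<Sum>j=1..n. (w i j)\<^sup>2) / 2 + (\<Sum>i=1..n. \<Sum>j=1..n. (G i j)\<^sup>2) / 2"
    by (simp add: sum.distrib sum_divide_distrib)
  also have "\<dots> \<le> (6 * n * V + 12 * (real n)\<^sup>2) / 2 + 7 * ((real n)\<^sup>2 + 2 * n * (\<Sum>i=1..n. (R i)\<^sup>2) + S\<^sup>2 + 3 * n * V) / 2"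
    using Sw SG by (intro add_mono divide_right_mono) auto
  finally have "p * (\<Sum>i=1..n. \<Sum>j=1..n. w i j * G i j) \<le>
     p * ((6 * n * V + 12 * (real n)\<^sup>2) / 2 + 7 * ((real n)\<^sup>2 + 2 * n * (\<Sum>i=1..n. (R i)\<^sup>2) + S\<^sup>2 + 3 * n * V) / 2)"
    using p0 by (intro mult_left_mono) auto
  also have "\<dots> = 27 / 2 * n * (p * V) + 19 / 2 * (p * (real n)\<^sup>2) + 7 * n * ((\<Sum>i=1..n. (R i)\<^sup>2) * p) + 7 / 2 * (S\<^sup>2 * p)"
    by (simp add: field_simps)
  \<comment> \<open>The coefficient \<open>19 / 2\<close> is raised to \<open>27 / 2 * n\<close> so
    that the first two terms combine to a multiple of \<open>p * (V + n^2) = 1\<close>.\<close>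
  also have "\<dots> \<le> 27 / 2 * n * (p * V) + 27 / 2 * n * (p * (real n)\<^sup>2) + 7 * n * ((\<Sum>i=1..n. (R i)\<^sup>2) * p) + 7 / 2 * (S\<^sup>2 * p)"
    using p0 N V0 sum_nonneg[of "{1..n}" "\<lambda>i. (R i)\<^sup>2"]
    by (intro add_mono mult_right_mono) (auto intro!: mult_nonneg_nonneg)
  also have "27 / 2 * n * (p * V) + 27 / 2 * n * (p * (real n)\<^sup>2) = 27 / 2 * n * (p * (V + (real n)\<^sup>2))"
    by (simp add: algebra_simps)
  also have "\<dots> = 27 / 2 * n" unfolding pN by simp
  finally have *: "p * (\<Sum>i=1..n. \<Sum>j=1..n. w i j * G i j) \<le>
    27 / 2 * n + 7 * n * ((\<Sum>i=1..n. (R i)\<^sup>2) * p) + 7 / 2 * (S\<^sup>2 * p)" .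
  have p1: "p \<le> 1 / (real n)\<^sup>2" using pn N by (simp add: field_simps)
  have "7 * n * ((\<Sum>i=1..n. (R i)\<^sup>2) * p) \<le> 7 * n * ((\<Sum>i=1..n. (R i)\<^sup>2) * (1 / (real n)\<^sup>2))"
    using p1 by (intro mult_left_mono sum_nonneg) auto
  also have "\<dots> = 7 * (\<Sum>i=1..n. (R i)\<^sup>2) / n" using N by (simp add: power2_eq_square)
  finally have **: "7 * n * ((\<Sum>i=1..n. (R i)\<^sup>2) * p) \<le> 7 * (\<Sum>i=1..n. (R i)\<^sup>2) / n" .
  have "S\<^sup>2 * p \<le> S\<^sup>2 * (1 / (real n)\<^sup>2)" using p1 by (intro mult_left_mono) auto
  then show ?thesis using * ** N unfolding w_def G_def D_def p_def by simp
qed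

text \<open>After normalisation the coefficient of |Q| is at most \<open>112 / n\<close>. Young's
  inequality splits off half of \<open>p * Q^2\<close>, a term the final estimate can absorb; the
  remainder \<open>(112 / n)^2 / (2 * p)\<close> is O(n) because V is at most
  \<open>n^3\<close>.\<close>

lemma sum_precision_centred_score_le:
  fixes Q :: real
  assumes y: "spins n y" and n: "n \<ge> 2"
  shows "precision n y * (\<Sum>i=1..n. \<Sum>j=1..n.
      (88 / n + 4 * (\<bar>dev n y i\<bar> + \<bar>dev n y j\<bar> + 2)\<^sup>2 / (real n)\<^sup>2) * \<bar>Q\<bar>)
    \<le> precision n y * Q\<^sup>2 / 2 + 12544 * n"
proof -
  define V p where "V = dispersion n y" and "p = precision n y"
  have p0: "p > 0" using precision_pos[OF y] n by (simp add: p_def)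
  have V0: "V \<ge> 0" using dispersion_nonneg[OF y] by (simp add: V_def)
  have N: "real n \<ge> 2" using n by simp
  have pN: "p * (V + (real n)\<^sup>2) = 1" using precision_mult[OF y] n by (simp add: p_def V_def)
  have "(\<Sum>i=1..n. \<Sum>j=1..n. (88 / n + 4 * (\<bar>dev n y i\<bar> + \<bar>dev n y j\<bar> + 2)\<^sup>2 / (real n)\<^sup>2) * \<bar>Q\<bar>)
     = (88 * n + 4 * (\<Sum>i=1..n. \<Sum>j=1..n. (\<bar>dev n y i\<bar> + \<bar>dev n y j\<bar> + 2)\<^sup>2) / (real n)\<^sup>2) * \<bar>Q\<bar>"
    using N by (simp add: sum.distrib sum_distrib_left sum_distrib_right sum_divide_distrib distrib_right)
  also have "\<dots> \<le> (88 * n + 4 * (6 * n * V + 12 * (real n)\<^sup>2) / (real n)\<^sup>2) * \<bar>Q\<bar>"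
    using sum_sq_bound[OF y] unfolding V_def by (intro mult_right_mono add_mono divide_right_mono) auto
  also have "\<dots> = (88 * n + 24 * V / n + 48) * \<bar>Q\<bar>"
    using N by (simp add: power2_eq_square field_simps)
  \<comment> \<open>\<open>112 = 88 + 24\<close>, where \<open>48 \<le> 24 * n\<close>.\<close>
  also have "\<dots> \<le> (112 * (V + (real n)\<^sup>2) / n) * \<bar>Q\<bar>"
  proof (intro mult_right_mono)
    have "24 * V / n \<le> 112 * V / n" using V0 by (intro divide_right_mono) auto
    moreover have "112 * (V + (real n)\<^sup>2) / n = 112 * V / n + 112 * n"
      using N by (simp add: power2_eq_square field_simps)
    ultimately show "88 * n + 24 * V / n + 48 \<le> 112 * (V + (real n)\<^sup>2) / n" using N by linarith
  qed auto
  finally have "p * (\<Sum>i=1..n. \<Sum>j=1..n. (88 / n + 4 * (\<bar>dev n y i\<bar> + \<bar>dev n y j\<bar> + 2)\<^sup>2 / (real n)\<^sup>2) * \<bar>Q\<bar>)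
     \<le> p * ((112 * (V + (real n)\<^sup>2) / n) * \<bar>Q\<bar>)"
    using p0 by (intro mult_left_mono) auto
  also have "\<dots> = p * (V + (real n)\<^sup>2) * (112 / n * \<bar>Q\<bar>)" by simp
  also have "\<dots> = 112 / n * \<bar>Q\<bar>" unfolding pN by simp
  also have "\<dots> \<le> p * Q\<^sup>2 / 2 + (112 / n)\<^sup>2 / (2 * p)"
  proof -
    have "0 \<le> (p * \<bar>Q\<bar> - 112 / n)\<^sup>2 / (2 * p)" using p0 by simp
    also have "\<dots> = p * Q\<^sup>2 / 2 + (112 / n)\<^sup>2 / (2 * p) - 112 / n * \<bar>Q\<bar>"
      using p0 N by (simp add: power2_diff power_mult_distrib) (simp add: field_simps power2_eq_square)
    finally show ?thesis by simp
  qed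
  also have "(112 / n)\<^sup>2 / (2 * p) \<le> 12544 * n"
  proof -
    have "V \<le> real n ^ 3" using dispersion_le[OF y] by (simp add: V_def)
    also have "real n ^ 3 + (real n)\<^sup>2 \<le> 2 * real n ^ 3"
      using power_increasing[of 2 3 "real n"] N by simp
    finally have "V + (real n)\<^sup>2 \<le> 2 * real n ^ 3" by simp
    moreover have "1 / p = V + (real n)\<^sup>2" using pN p0 by (simp add: field_simps)
    ultimately have "1 / p \<le> 2 * real n ^ 3" by simp
    then have "(112 / n)\<^sup>2 / 2 * (1 / p) \<le> (112 / n)\<^sup>2 / 2 * (2 * real n ^ 3)"
      by (intro mult_left_mono) auto
    then show ?thesis using N by (simp add: power2_eq_square power3_eq_cube field_simps)
  qed
  finally show ?thesis by (simp add: p_def)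
qed

text \<open>Twice the constant of an estimate whose right-hand side contains half of the left:
  \<open>66 = 2 * 33\<close>, \<open>25088 = 2 * 12544\<close>, \<open>45 = 17 + 14 + 14\<close>,
  \<open>112 = 56 + 56\<close>.\<close>

definition centred_score_const :: "real \<Rightarrow> real" where
  "centred_score_const \<theta> = 66 * (72 + 224 * \<theta>) * (45 + 112 * \<theta>) + 25088"

text \<open>One factor Q is expanded into residuals, and the flip identity is applied with the rest,
  \<open>coef\<close>, normaliser and second Q, as test function. The bound obtained contains half
  of the expectation \<open>X\<close> in question, which is then subtracted.\<close>

lemma expect_centred_score_sq_le:
  assumes \<theta>: "\<theta> \<ge> 0" and n: "n \<ge> 2"
  shows "expect \<theta> \<beta> n (\<lambda>y. precision n y * (centred_score \<theta> \<beta> n y)\<^sup>2) \<le> centred_score_const \<theta> * n"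
proof -
  define L where "L = 72 + 224 * \<theta>"
  define X where "X = expect \<theta> \<beta> n (\<lambda>y. precision n y * (centred_score \<theta> \<beta> n y)\<^sup>2)"
  define w where "w y i j = \<bar>dev n y i\<bar> + \<bar>dev n y j\<bar> + 2" for y i j
  define G where "G y i j = 1 + \<bar>row_resid \<theta> \<beta> n y i\<bar> + \<bar>row_resid \<theta> \<beta> n y j\<bar> + \<bar>score \<theta> \<beta> n y\<bar> / n
     + \<bar>dev n y i\<bar> + \<bar>dev n y j\<bar> + (\<Sum>k=1..n. \<bar>dev n y k\<bar>) / n" for y i j
  define B where "B y i j = precision n y * (33 * L * (w y i j * G y i j) +
     (88 / n + 4 * (w y i j)\<^sup>2 / (real n)\<^sup>2) * \<bar>centred_score \<theta> \<beta> n y\<bar>)" for y i j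
  have L: "L \<ge> 0" using \<theta> by (simp add: L_def)
  have w0: "w y i j \<ge> 0" and G0: "G y i j \<ge> 0" for y i j
    unfolding w_def G_def by (auto intro!: add_nonneg_nonneg divide_nonneg_nonneg sum_nonneg)
  have p0: "precision n y > 0" if "spins n y" for y
    using precision_pos[OF that] n by simp
  have "X = (\<Sum>i=1..n. \<Sum>j=1..n. expect \<theta> \<beta> n (\<lambda>y. resid \<theta> \<beta> n y i j *
      (coef n y i j * (precision n y * centred_score \<theta> \<beta> n y))))"
    unfolding X_def expect_sum[symmetric]
  proof (rule expect_cong)
    fix y
    have "precision n y * (centred_score \<theta> \<beta> n y)\<^sup>2 = centred_score \<theta> \<beta> n y * (precision n y * centred_score \<theta> \<beta> n y)"
      by (simp add: power2_eq_square)
    also have "\<dots> = (\<Sum>i=1..n. \<Sum>j=1..n. coef n y i j * resid \<theta> \<beta> n y i j) * (precision n y * centred_score \<theta> \<beta> n y)"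
      by (simp add: centred_score_def)
    also have "\<dots> = (\<Sum>i=1..n. \<Sum>j=1..n. resid \<theta> \<beta> n y i j *
      (coef n y i j * (precision n y * centred_score \<theta> \<beta> n y)))"
      unfolding sum_distrib_right by (intro sum.cong refl) simp
    finally show "precision n y * (centred_score \<theta> \<beta> n y)\<^sup>2 = \<dots>" .
  qed
  also have "\<dots> \<le> (\<Sum>i=1..n. \<Sum>j=1..n. expect \<theta> \<beta> n (\<lambda>y. B y i j))"
  proof (intro sum_mono expect_resid_le)
    fix i j y assume ij: "i \<in> {1..n}" "j \<in> {1..n}" and y: "spins n y"
    show "0 \<le> B y i j" unfolding B_def using w0 G0 L p0[OF y] by simp
    assume "i \<noteq> j"
    note flip = y ij this
    show "\<bar>coef n y i j * (precision n y * centred_score \<theta> \<beta> n y) - coef n (flip i j y) i j *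
       (precision n (flip i j y) * centred_score \<theta> \<beta> n (flip i j y))\<bar> \<le> B y i j"
    proof (rule order_trans[OF abs_weighted_centred_score_flip_le[OF flip]])
      have "33 * w y i j * \<bar>centred_score \<theta> \<beta> n y - centred_score \<theta> \<beta> n (flip i j y)\<bar> \<le> 33 * w y i j * (L * G y i j)"
        using abs_centred_score_flip_le[OF flip \<theta>, of \<beta>] w0 by (intro mult_left_mono) (auto simp: L_def G_def)
      then show "precision n y * (33 * (\<bar>dev n y i\<bar> + \<bar>dev n y j\<bar> + 2) * \<bar>centred_score \<theta> \<beta> n y - centred_score \<theta> \<beta> n (flip i j y)\<bar> +
          (88 / n + 4 * (\<bar>dev n y i\<bar> + \<bar>dev n y j\<bar> + 2)\<^sup>2 / (real n)\<^sup>2) * \<bar>centred_score \<theta> \<beta> n y\<bar>) \<le> B y i j"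
        unfolding B_def w_def[symmetric] using p0[OF y] by (intro mult_left_mono add_mono) (auto simp: mult.assoc mult.left_commute)
    qed
  qed
  also have "\<dots> = expect \<theta> \<beta> n (\<lambda>y. \<Sum>i=1..n. \<Sum>j=1..n. B y i j)"
    by (simp add: expect_sum)
  also have "\<dots> \<le> expect \<theta> \<beta> n (\<lambda>y. (33 * L * (17 * n) + 12544 * n) + ((33 * L * 7 / n * (\<Sum>i=1..n. (row_resid \<theta> \<beta> n y i)\<^sup>2))
     + (33 * L * (7 / 2) / (real n)\<^sup>2 * (score \<theta> \<beta> n y)\<^sup>2 + 1 / 2 * (precision n y * (centred_score \<theta> \<beta> n y)\<^sup>2))))"
  proof (rule expect_mono)
    fix y assume y: "spins n y"
    have "(\<Sum>i=1..n. \<Sum>j=1..n. B y i j) = 33 * L * (precision n y * (\<Sum>i=1..n. \<Sum>j=1..n. w y i j * G y i j))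
      + precision n y * (\<Sum>i=1..n. \<Sum>j=1..n. (88 / n + 4 * (w y i j)\<^sup>2 / (real n)\<^sup>2) * \<bar>centred_score \<theta> \<beta> n y\<bar>)"
      unfolding B_def by (simp add: sum.distrib sum_distrib_left distrib_left mult.assoc mult.left_commute)
    also have "\<dots> \<le> 33 * L * (17 * n + 7 * (\<Sum>i=1..n. (row_resid \<theta> \<beta> n y i)\<^sup>2) / n + 7 / 2 * (score \<theta> \<beta> n y)\<^sup>2 / (real n)\<^sup>2)
       + (precision n y * (centred_score \<theta> \<beta> n y)\<^sup>2 / 2 + 12544 * n)"
      using weighted_increments_le[OF y, of \<theta> \<beta>] sum_precision_centred_score_le[OF y n, of "centred_score \<theta> \<beta> n y"] L n
      unfolding w_def G_def by (intro add_mono mult_left_mono) auto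
    finally show "(\<Sum>i=1..n. \<Sum>j=1..n. B y i j) \<le> (33 * L * (17 * n) + 12544 * n) + ((33 * L * 7 / n * (\<Sum>i=1..n. (row_resid \<theta> \<beta> n y i)\<^sup>2))
     + (33 * L * (7 / 2) / (real n)\<^sup>2 * (score \<theta> \<beta> n y)\<^sup>2 + 1 / 2 * (precision n y * (centred_score \<theta> \<beta> n y)\<^sup>2)))"
      by (simp add: algebra_simps)
  qed
  also have "\<dots> = (33 * L * (17 * n) + 12544 * n) + (33 * L * 7 / n * (\<Sum>i=1..n. expect \<theta> \<beta> n (\<lambda>y. (row_resid \<theta> \<beta> n y i)\<^sup>2))
     + (33 * L * (7 / 2) / (real n)\<^sup>2 * expect \<theta> \<beta> n (\<lambda>y. (score \<theta> \<beta> n y)\<^sup>2) + 1 / 2 * X))"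
    unfolding X_def expect_add expect_const expect_cmult expect_sum ..
  also have "\<dots> \<le> (33 * L * (17 * n) + 12544 * n) + (33 * L * 7 / n * (\<Sum>i=1..n. (2 + 8 * \<theta>) * n)
     + (33 * L * (7 / 2) / (real n)\<^sup>2 * ((4 + 16 * \<theta>) * (real n)\<^sup>2) + 1 / 2 * X))"
    using L by (intro add_mono mult_left_mono sum_mono expect_row_resid_sq_le[OF \<theta>] expect_score_sq_le[OF \<theta>] order.refl) auto
  also have "\<dots> = (33 * L * (17 + 14 + 56 * \<theta>) + 12544) * n + 33 * L * (14 + 56 * \<theta>) + X / 2"
    using n by (simp add: power2_eq_square field_simps)
  finally have "X \<le> (33 * L * (17 + 14 + 56 * \<theta>) + 12544) * n + 33 * L * (14 + 56 * \<theta>) + X / 2" .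
  moreover have "33 * L * (14 + 56 * \<theta>) \<le> 33 * L * (14 + 56 * \<theta>) * n"
    using mult_left_mono[of 1 "real n" "33 * L * (14 + 56 * \<theta>)"] n L \<theta> by simp
  moreover have "X \<le> 2 * (u + w)" if "X \<le> u + v + X / 2" "v \<le> w" for u v w
    using that unfolding distrib_left by linarith
  ultimately have "X \<le> 2 * ((33 * L * (17 + 14 + 56 * \<theta>) + 12544) * n + 33 * L * (14 + 56 * \<theta>) * n)"
    by blast
  also have "\<dots> = centred_score_const \<theta> * n"
    by (simp add: centred_score_const_def L_def algebra_simps)
  finally show ?thesis by (simp add: X_def)
qed

section \<open>Identifiability\<close>

definition offsum :: "nat \<Rightarrow> (nat \<Rightarrow> nat \<Rightarrow> real) \<Rightarrow> real" where
  "offsum n f = (\<Sum>i=1..n. \<Sum>j\<in>{1..n} - {i}. f i j)"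

lemma offsum_eq: "offsum n f = (\<Sum>i=1..n. \<Sum>j=1..n. f i j) - (\<Sum>i=1..n. f i i)"
  unfolding offsum_def sum_subtractf[symmetric] by (intro sum.cong refl) (simp add: sum_diff1)

lemma offsum_cong:
  "(\<And>i j. i \<in> {1..n} \<Longrightarrow> j \<in> {1..n} \<Longrightarrow> i \<noteq> j \<Longrightarrow> f i j = g i j) \<Longrightarrow> offsum n f = offsum n g"
  unfolding offsum_def by (intro sum.cong) auto

lemma offsum_mono:
  "(\<And>i j. i \<in> {1..n} \<Longrightarrow> j \<in> {1..n} \<Longrightarrow> i \<noteq> j \<Longrightarrow> f i j \<le> g i j) \<Longrightarrow> offsum n f \<le> offsum n g"
  unfolding offsum_def by (intro sum_mono) auto

lemma offsum_add: "offsum n (\<lambda>i j. f i j + g i j) = offsum n f + offsum n g"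
  by (simp add: offsum_def sum.distrib)

lemma offsum_diff: "offsum n (\<lambda>i j. f i j - g i j) = offsum n f - offsum n g"
  by (simp add: offsum_def sum_subtractf)

lemma offsum_cmult: "offsum n (\<lambda>i j. c * f i j) = c * offsum n f"
  by (simp add: offsum_def sum_distrib_left)

lemma offsum_const: "offsum n (\<lambda>i j. c) = real n * (real n - 1) * c"
  by (simp add: offsum_eq algebra_simps)

lemma abs_offsum_le: "\<bar>offsum n f\<bar> \<le> offsum n (\<lambda>i j. \<bar>f i j\<bar>)"
  unfolding offsum_def by (intro order_trans[OF sum_abs] sum_mono order.refl)

context
  fixes n :: nat and y :: "nat \<Rightarrow> nat \<Rightarrow> real"
  assumes y: "spins n y" and n: "n \<ge> 2"
begin

lemma score_eq_offsum:
  "score \<theta> \<beta> n y = offsum n (\<lambda>i j. y i j - tanh (\<beta> + \<theta> * field n y i j))"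
proof -
  have "score \<theta> \<beta> n y = offsum n (resid \<theta> \<beta> n y)"
    by (simp add: score_def row_resid_def offsum_eq resid_def)
  also have "\<dots> = offsum n (\<lambda>i j. y i j - tanh (\<beta> + \<theta> * field n y i j))"
    by (intro offsum_cong) (simp add: resid_def)
  finally show ?thesis .
qed

lemma centred_score_eq_offsum:
  "centred_score \<theta> \<beta> n y = offsum n (\<lambda>i j. coef n y i j * (y i j - tanh (\<beta> + \<theta> * field n y i j)))"
proof -
  have "centred_score \<theta> \<beta> n y = offsum n (\<lambda>i j. coef n y i j * resid \<theta> \<beta> n y i j)"
    by (simp add: centred_score_def offsum_eq resid_def)
  also have "\<dots> = offsum n (\<lambda>i j. coef n y i j * (y i j - tanh (\<beta> + \<theta> * field n y i j)))"
    by (intro offsum_cong) (simp add: resid_def)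
  finally show ?thesis .
qed

lemma sum_spins: "(\<Sum>i=1..n. \<Sum>j=1..n. y i j) = n * avg n y"
  using sum_rowsum[OF y] by (simp add: rowsum_def)

lemma sum_spin_square: "(\<Sum>i=1..n. \<Sum>j=1..n. (y i j)\<^sup>2) = real n * (real n - 1)"
proof -
  have "(\<Sum>i=1..n. \<Sum>j=1..n. (y i j)\<^sup>2) = offsum n (\<lambda>i j. (y i j)\<^sup>2)"
    using spins_diag[OF y] by (simp add: offsum_eq)
  also have "\<dots> = offsum n (\<lambda>i j. 1)" by (intro offsum_cong spins_square[OF y])
  finally show ?thesis by (simp add: offsum_const)
qed

lemma sum_dev_spin:
  "(\<Sum>i=1..n. \<Sum>j=1..n. dev n y i * y i j) = dispersion n y"
  "(\<Sum>i=1..n. \<Sum>j=1..n. dev n y j * y i j) = dispersion n y"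
proof -
  show *: "(\<Sum>i=1..n. \<Sum>j=1..n. dev n y i * y i j) = dispersion n y"
    by (simp add: dispersion_eq[OF y] rowsum_def sum_distrib_left)
  have "(\<Sum>i=1..n. \<Sum>j=1..n. dev n y j * y i j) = (\<Sum>j=1..n. \<Sum>i=1..n. dev n y j * y j i)"
    using spins_sym[OF y] by (subst sum.swap) simp
  then show "(\<Sum>i=1..n. \<Sum>j=1..n. dev n y j * y i j) = dispersion n y"
    using * by simp
qed

text \<open>The deviations cancel, but the self-exclusion term does not; so the coordinates u and v
  below are only nearly orthogonal.\<close>

lemma offsum_coef: "offsum n (coef n y) = - 2 * real n * avg n y"
  using sum_dev[OF y] spins_diag[OF y]
  by (simp add: offsum_eq coef_def sum.distrib sum_subtractf sum_spins flip: sum_distrib_left)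

lemma offsum_coef_spin:
  "offsum n (\<lambda>i j. coef n y i j * y i j) = 2 * dispersion n y - 2 * real n * (real n - 1)"
proof -
  have "coef n y i j * y i j = dev n y i * y i j + dev n y j * y i j - 2 * (y i j)\<^sup>2" for i j
    by (simp add: coef_def power2_eq_square algebra_simps)
  then show ?thesis
    using spins_diag[OF y]
    by (simp add: offsum_eq sum.distrib sum_subtractf sum_dev_spin(2) sum_spin_square
        sum_dev_spin(1)[unfolded sum_distrib_left[symmetric]] flip: sum_distrib_left)
qed

text \<open>In \<open>12 = 8 + 4\<close> the 8 comes from the products of deviations and spins, the
  4 from removing the diagonal, where \<open>coef\<close> is twice the deviation.\<close>

lemma offsum_coef_sq:
  "offsum n (\<lambda>i j. (coef n y i j)\<^sup>2) = (2 * real n - 12) * dispersion n y + 4 * real n * (real n - 1)"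
proof -
  have "(\<Sum>i=1..n. \<Sum>j=1..n. (coef n y i j)\<^sup>2) = (\<Sum>i=1..n. \<Sum>j=1..n.
     (dev n y i)\<^sup>2 + (dev n y j)\<^sup>2 + 2 * (dev n y i * dev n y j) + 4 * (y i j)\<^sup>2
       - 4 * (dev n y i * y i j) - 4 * (dev n y j * y i j))"
    by (intro sum.cong refl) (simp add: coef_def power2_eq_square algebra_simps)
  also have "\<dots> = 2 * n * dispersion n y + 4 * (real n * (real n - 1)) - 8 * dispersion n y"
    by (simp add: sum.distrib sum_subtractf sum_dev_spin(2) sum_spin_square
        sum_dev_spin(1)[unfolded sum_distrib_left[symmetric]] sum_dev[OF y]
        dispersion_def[symmetric] flip: sum_distrib_left)
  finally have *: "(\<Sum>i=1..n. \<Sum>j=1..n. (coef n y i j)\<^sup>2) =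
      2 * n * dispersion n y + 4 * (real n * (real n - 1)) - 8 * dispersion n y" .
  have "(\<Sum>i=1..n. (coef n y i i)\<^sup>2) = 4 * dispersion n y"
    using spins_diag[OF y] by (simp add: coef_def dispersion_def power_mult_distrib sum_distrib_left flip: mult_2)
  then show ?thesis unfolding offsum_eq * by (simp add: algebra_simps)
qed

lemma field_eq: "field n y i j = (coef n y i j + 2 * avg n y) / (real n - 1)"
  by (simp add: field_def coef_def dev_def)

lemma avg_frac_le: "\<bar>2 * avg n y / (real n - 1)\<bar> \<le> 2"
  using abs_avg_le[OF y] n by (simp add: abs_divide field_simps)

lemma abs_field_le:
  assumes "i \<in> {1..n}" "j \<in> {1..n}" "i \<noteq> j"
  shows "\<bar>field n y i j\<bar> \<le> 2"
proof -
  have *: "\<bar>rowsum n y k - y i j\<bar> \<le> real n - 1" if "k = i \<and> l = j \<or> k = j \<and> l = i" for k l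
  proof -
    have k: "k \<in> {1..n}" "l \<in> {1..n}" "l \<noteq> k" "y i j = y k l"
      using that assms spins_sym[OF y, of i j] by auto
    have "rowsum n y k - y i j = (\<Sum>m\<in>{1..n} - {k} - {l}. y k m)"
      using k spins_diag[OF y] by (simp add: rowsum_def sum_diff1)
    also have "\<bar>\<dots>\<bar> \<le> (\<Sum>m\<in>{1..n} - {k} - {l}. 1)"
      using k spins_abs_le[OF y] by (intro order_trans[OF sum_abs] sum_mono) auto
    also have "\<dots> \<le> real n - 1" using k by (simp add: of_nat_diff)
    finally show ?thesis .
  qed
  have "\<bar>rowsum n y i + rowsum n y j - 2 * y i j\<bar> \<le> 2 * (real n - 1)"
    using *[of i j] *[of j i] by (simp add: abs_le_iff)
  then show ?thesis using n by (simp add: field_def abs_divide field_simps)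
qed

text \<open>With tanh replaced by its mean-field value \<mu>, the centred score is
  \<open>2 * V - 2 * n * (n - 1) + 2 * n * \<mu> * avg n y\<close>. Since |\<mu>| stays below 1, the
  last two terms have order \<open>n^2\<close>, and either V or the score must compensate.\<close>

lemma dispersion_lower:
  fixes \<theta> \<beta> :: real
  assumes \<theta>: "\<theta> \<ge> 0"
  shows "2 * (1 - tanh (\<bar>\<beta>\<bar> + 2 * \<theta>)) * (real n * (real n - 1))
    \<le> (2 + 2 * \<theta>) * dispersion n y + 4 * \<theta> * n + \<bar>centred_score \<theta> \<beta> n y\<bar>"
proof -
  define N V T where "N = real n - 1" and "V = dispersion n y" and "T = tanh (\<bar>\<beta>\<bar> + 2 * \<theta>)"
  define m where "m i j = tanh (\<beta> + \<theta> * field n y i j)" for i j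
  define z where "z = 2 * avg n y / N"
  define \<mu> where "\<mu> = tanh (\<beta> + \<theta> * z)"
  have N: "N \<ge> 1" using n by (simp add: N_def)
  have V: "V \<ge> 0" using dispersion_nonneg[OF y] by (simp add: V_def)
  have z: "\<bar>z\<bar> \<le> 2" using avg_frac_le by (simp add: z_def N_def)
  have "\<bar>\<theta> * z\<bar> \<le> \<theta> * 2" unfolding abs_mult using \<theta> z by (intro mult_mono) auto
  then have "\<bar>\<beta> + \<theta> * z\<bar> \<le> \<bar>\<beta>\<bar> + 2 * \<theta>" by linarith
  then have \<mu>: "\<bar>\<mu>\<bar> \<le> T" by (simp add: \<mu>_def T_def flip: tanh_real_abs)
  \<comment> \<open>Replacing the tanh values by \<mu> costs a multiple of the dispersion plus O(n),
    by the Lipschitz bound.\<close>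
  have "\<bar>offsum n (\<lambda>i j. coef n y i j * (m i j - \<mu>))\<bar> \<le> offsum n (\<lambda>i j. \<theta> / N * (coef n y i j)\<^sup>2)"
  proof (rule order_trans[OF abs_offsum_le offsum_mono])
    fix i j assume "i \<in> {1..n}" "j \<in> {1..n}"
    have "\<bar>m i j - \<mu>\<bar> \<le> \<bar>(\<beta> + \<theta> * field n y i j) - (\<beta> + \<theta> * z)\<bar>"
      unfolding m_def \<mu>_def by (rule abs_tanh_diff_le)
    also have "(\<beta> + \<theta> * field n y i j) - (\<beta> + \<theta> * z) = \<theta> / N * coef n y i j"
      unfolding field_eq z_def N_def[symmetric] using N by (simp add: field_simps)
    also have "\<bar>\<dots>\<bar> = \<theta> / N * \<bar>coef n y i j\<bar>" using \<theta> N by (simp add: abs_mult)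
    finally have "\<bar>coef n y i j\<bar> * \<bar>m i j - \<mu>\<bar> \<le> \<bar>coef n y i j\<bar> * (\<theta> / N * \<bar>coef n y i j\<bar>)"
      by (rule mult_left_mono) auto
    also have "\<dots> = \<theta> / N * \<bar>coef n y i j\<bar>\<^sup>2" unfolding power2_eq_square by simp
    finally show "\<bar>coef n y i j * (m i j - \<mu>)\<bar> \<le> \<theta> / N * (coef n y i j)\<^sup>2" by (simp add: abs_mult)
  qed
  also have "\<dots> = \<theta> / N * ((2 * real n - 12) * V + 4 * real n * N)"
    unfolding offsum_cmult offsum_coef_sq V_def N_def ..
  also have "\<dots> \<le> \<theta> / N * ((2 * N) * V + 4 * n * N)"
    using \<theta> N V by (intro mult_left_mono add_mono mult_right_mono) (auto simp: N_def)
  also have "\<dots> = 2 * \<theta> * V + 4 * \<theta> * n" using N by (simp add: field_simps)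
  finally have 1: "\<bar>offsum n (\<lambda>i j. coef n y i j * (m i j - \<mu>))\<bar> \<le> 2 * \<theta> * V + 4 * \<theta> * n" .
  have "coef n y i j * (y i j - m i j) = coef n y i j * y i j - coef n y i j * (m i j - \<mu>) - \<mu> * coef n y i j" for i j
    by (simp add: algebra_simps)
  then have "centred_score \<theta> \<beta> n y = (2 * V - 2 * real n * N) - offsum n (\<lambda>i j. coef n y i j * (m i j - \<mu>)) - \<mu> * (- 2 * real n * avg n y)"
    unfolding centred_score_eq_offsum m_def[symmetric]
    by (simp add: offsum_diff offsum_cmult offsum_coef_spin offsum_coef V_def N_def)
  moreover have "\<bar>\<mu> * (- 2 * real n * avg n y)\<bar> \<le> T * (2 * n * N)"
    unfolding abs_mult using \<mu> abs_avg_le[OF y] n by (intro mult_mono) (auto simp: N_def)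
  ultimately have "2 * real n * N \<le> 2 * V + (2 * \<theta> * V + 4 * \<theta> * n) + T * (2 * n * N) + \<bar>centred_score \<theta> \<beta> n y\<bar>"
    using 1 by linarith
  then show ?thesis unfolding N_def[symmetric] T_def[symmetric] V_def[symmetric] by (simp add: algebra_simps)
qed

text \<open>The squared quantity is the change \<open>w\<close> of the argument of tanh at an edge.
  The right-hand side is the sum of \<open>w\<close> times the change of tanh, so
  \<open>tanh_increment_ge\<close> applies edge by edge, and
  \<open>\<bar>u\<bar> + 4 * \<bar>v\<bar>\<close> bounds every \<open>w\<close>.\<close>

lemma score_difference_ge:
  fixes \<theta> \<beta> \<theta>' \<beta>' :: real
  defines "v \<equiv> \<theta>' - \<theta>" and "u \<equiv> \<beta>' - \<beta> + (\<theta>' - \<theta>) * (2 * avg n y / (real n - 1))"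
  assumes \<theta>: "\<theta> \<ge> 0"
  shows "(1 - tanh (\<bar>\<beta>\<bar> + 2 * \<theta>)) / (1 + (\<bar>u\<bar> + 4 * \<bar>v\<bar>)) * offsum n (\<lambda>i j. (u + v / (real n - 1) * coef n y i j)\<^sup>2)
     \<le> u * (score \<theta> \<beta> n y - score \<theta>' \<beta>' n y) + v / (real n - 1) * (centred_score \<theta> \<beta> n y - centred_score \<theta>' \<beta>' n y)"
proof -
  define \<eta> where "\<eta> = 1 - tanh (\<bar>\<beta>\<bar> + 2 * \<theta>)"
  define W where "W = \<bar>u\<bar> + 4 * \<bar>v\<bar>"
  define w where "w i j = u + v / (real n - 1) * coef n y i j" for i j
  define x where "x i j = \<beta> + \<theta> * field n y i j" for i j
  have \<eta>: "\<eta> > 0" using tanh_real_lt_1 by (simp add: \<eta>_def)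
  have n1: "real n - 1 > 0" using n by simp
  have xw: "\<beta>' + \<theta>' * field n y i j = x i j + w i j" for i j
    unfolding x_def w_def field_eq u_def v_def
    by (simp add: algebra_simps add_divide_distrib diff_divide_distrib)
  have le: "\<eta> / (1 + W) * (w i j)\<^sup>2 \<le> w i j * (tanh (x i j + w i j) - tanh (x i j))"
    if ij: "i \<in> {1..n}" "j \<in> {1..n}" "i \<noteq> j" for i j
  proof -
    have f: "\<bar>field n y i j\<bar> \<le> 2" by (rule abs_field_le[OF ij])
    have "\<bar>\<theta> * field n y i j\<bar> \<le> \<theta> * 2" unfolding abs_mult using \<theta> f by (intro mult_mono) auto
    then have x: "\<bar>x i j\<bar> \<le> \<bar>\<beta>\<bar> + 2 * \<theta>" unfolding x_def by linarith
    have "coef n y i j / (real n - 1) = field n y i j - 2 * avg n y / (real n - 1)"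
      unfolding field_eq by (simp add: add_divide_distrib)
    then have "\<bar>coef n y i j / (real n - 1)\<bar> \<le> 4" using f avg_frac_le by linarith
    then have "\<bar>v * (coef n y i j / (real n - 1))\<bar> \<le> \<bar>v\<bar> * 4"
      unfolding abs_mult by (intro mult_left_mono) auto
    moreover have "w i j = u + v * (coef n y i j / (real n - 1))" by (simp add: w_def)
    ultimately have w: "\<bar>w i j\<bar> \<le> W" unfolding W_def by linarith
    have "\<eta> / (1 + W) * (w i j)\<^sup>2 = \<eta> * ((w i j)\<^sup>2 / (1 + W))" by simp
    also have "\<dots> \<le> \<eta> * ((w i j)\<^sup>2 / (1 + \<bar>w i j\<bar>))"
      using \<eta> w by (intro mult_left_mono divide_left_mono) auto
    also have "\<dots> \<le> w i j * (tanh (x i j + w i j) - tanh (x i j))"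
      unfolding \<eta>_def by (rule tanh_increment_ge[OF x])
    finally show ?thesis .
  qed
  have "\<eta> / (1 + W) * offsum n (\<lambda>i j. (w i j)\<^sup>2) \<le> offsum n (\<lambda>i j. w i j * (tanh (x i j + w i j) - tanh (x i j)))"
    unfolding offsum_cmult[symmetric] by (intro offsum_mono le)
  also have "\<dots> = offsum n (\<lambda>i j. u * ((y i j - tanh (x i j)) - (y i j - tanh (x i j + w i j)))
      + v / (real n - 1) * (coef n y i j * (y i j - tanh (x i j)) - coef n y i j * (y i j - tanh (x i j + w i j))))"
    by (intro offsum_cong) (simp add: w_def algebra_simps)
  also have "\<dots> = u * (score \<theta> \<beta> n y - score \<theta>' \<beta>' n y) + v / (real n - 1) * (centred_score \<theta> \<beta> n y - centred_score \<theta>' \<beta>' n y)"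
    unfolding score_eq_offsum centred_score_eq_offsum xw x_def[symmetric] offsum_add offsum_cmult offsum_diff ..
  finally show ?thesis unfolding \<eta>_def W_def w_def .
qed

end

lemma centred_score_le_of_precision:
  assumes y: "spins n y" and n: "n \<ge> 1" and q: "precision n y * q\<^sup>2 \<le> \<kappa>\<^sup>2 * n"
  shows "q\<^sup>2 \<le> \<kappa>\<^sup>2 * n * (dispersion n y + (real n)\<^sup>2)"
proof -
  define D where "D = dispersion n y + (real n)\<^sup>2"
  have "D > 0" using dispersion_nonneg[OF y] n unfolding D_def by (intro add_nonneg_pos) auto
  then show ?thesis using q unfolding precision_def D_def[symmetric] by (simp add: field_simps)
qed

text \<open>Otherwise V is at most \<open>n^2\<close>, so Q is at most
  \<open>2 * \<kappa> * n * sqrt n\<close>, while \<open>dispersion_lower\<close> demands order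
  \<open>n^2\<close>. The assumption \<open>large\<close> makes \<open>sqrt n\<close> big enough for
  a contradiction.\<close>

lemma dispersion_ge:
  fixes \<theta> \<beta> \<kappa> :: real
  defines "\<eta> \<equiv> 1 - tanh (\<bar>\<beta>\<bar> + 2 * \<theta>)"
  assumes y: "spins n y" and n: "n \<ge> 2" and \<theta>: "\<theta> \<ge> 0" and \<kappa>: "\<kappa> \<ge> 0"
    and large: "2 * (4 * \<theta> + 2 * \<kappa>) / \<eta> < sqrt n"
    and Q: "precision n y * (centred_score \<theta> \<beta> n y)\<^sup>2 \<le> \<kappa>\<^sup>2 * n"
  shows "\<eta> / (4 * (1 + \<theta>)) * (real n)\<^sup>2 \<le> dispersion n y"
proof (rule ccontr)
  define V q r where "V = dispersion n y" and "q = centred_score \<theta> \<beta> n y" and "r = sqrt n"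
  have r: "r \<ge> 1" "real n = r * r" using n by (auto simp: r_def)
  have \<eta>: "0 < \<eta>" "\<eta> \<le> 1" using tanh_real_lt_1 \<theta> by (auto simp: \<eta>_def)
  assume "\<not> ?thesis"
  then have less: "V < \<eta> / (4 * (1 + \<theta>)) * (real n)\<^sup>2" by (simp add: V_def)
  also have "\<dots> \<le> 1 * (real n)\<^sup>2" using \<eta> \<theta> by (intro mult_right_mono) (auto simp: field_simps)
  finally have "V \<le> (real n)\<^sup>2" by simp
  have "q\<^sup>2 \<le> \<kappa>\<^sup>2 * n * (V + (real n)\<^sup>2)"
    using centred_score_le_of_precision[OF y _ Q] n by (simp add: V_def q_def)
  also have "\<dots> \<le> \<kappa>\<^sup>2 * n * (4 * (real n)\<^sup>2)"
    using order_trans[OF \<open>V \<le> (real n)\<^sup>2\<close>, of "3 * (real n)\<^sup>2"] by (intro mult_left_mono) auto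
  also have "\<dots> = (2 * \<kappa> * n * r)\<^sup>2" by (simp add: r(2) power2_eq_square)
  finally have q: "\<bar>q\<bar> \<le> 2 * \<kappa> * n * r"
    using \<kappa> r by (simp flip: abs_le_square_iff)
  \<comment> \<open>The threshold is chosen so that this term uses up half of
    \<open>\<eta> * n^2\<close>.\<close>
  have "(2 + 2 * \<theta>) * V \<le> (2 + 2 * \<theta>) * (\<eta> / (4 * (1 + \<theta>)) * (real n)\<^sup>2)"
    using less \<theta> by (intro mult_left_mono) auto
  also have "\<dots> = \<eta> * (real n)\<^sup>2 / 2" using \<theta> by (simp add: field_simps)
  finally have 1: "(2 + 2 * \<theta>) * V \<le> \<eta> * (real n)\<^sup>2 / 2" .
  have "\<eta> * (real n * n) \<le> \<eta> * (real n * (2 * (real n - 1)))"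
    using \<eta> n by (intro mult_left_mono) auto
  then have 2: "\<eta> * (real n)\<^sup>2 \<le> 2 * \<eta> * (real n * (real n - 1))" by (simp add: power2_eq_square algebra_simps)
  have "4 * \<theta> * n * 1 \<le> 4 * \<theta> * n * r" using r \<theta> by (intro mult_left_mono) auto
  moreover have "2 * \<eta> * (real n * (real n - 1)) \<le> (2 + 2 * \<theta>) * V + 4 * \<theta> * n + \<bar>q\<bar>"
    unfolding \<eta>_def V_def q_def using dispersion_lower[OF y n \<theta>] by simp
  ultimately have "\<eta> * (real n)\<^sup>2 / 2 \<le> 4 * \<theta> * n * r + 2 * \<kappa> * n * r"
    using 1 2 q by linarith
  then have "(n * r) * (\<eta> * r) \<le> (n * r) * (2 * (4 * \<theta> + 2 * \<kappa>))"
    by (simp add: r(2) power2_eq_square algebra_simps)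
  then have "\<eta> * r \<le> 2 * (4 * \<theta> + 2 * \<kappa>)" using r n by (simp add: mult_le_cancel_left_pos)
  then show False using large \<eta> by (simp add: r_def field_simps)
qed

text \<open>\<open>A\<close> and \<open>B\<close> are |u| and |v| times their rates \<open>n\<close>
  and \<open>sqrt (V / n)\<close>. The quadratic form is at least \<open>(A^2 + B^2) / 4\<close>,
  the linear term at most \<open>\<kappa>\<^sub>1 * (A + B)\<close>. The factor
  \<open>1 / (1 + W)\<close> first yields only
  \<open>A + B \<le> \<kappa>\<^sub>2 * (1 + W)\<close>; as \<open>W\<close> is at most a small
  multiple of \<open>A + B\<close>, it is then absorbed.\<close>

lemma estimate_close:
  fixes \<theta> \<beta> \<theta>' \<beta>' \<delta> \<kappa> :: real
  defines "\<kappa>\<^sub>1 \<equiv> 2 * \<kappa> + 4 * \<kappa> * sqrt (2 / \<delta>)"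
  defines "\<kappa>\<^sub>2 \<equiv> 8 * \<kappa>\<^sub>1 / (1 - tanh (\<bar>\<beta>\<bar> + 2 * \<theta>))"
  assumes y: "spins n y" and n: "n \<ge> 12" and n\<delta>: "64 \<le> \<delta> * n" and large: "8 * \<kappa>\<^sub>2 \<le> sqrt (\<delta> * n)"
    and \<theta>: "\<theta> \<ge> 0" and \<delta>: "0 < \<delta>" "\<delta> \<le> 1" and \<kappa>: "\<kappa> \<ge> 0"
    and disp: "\<delta> * (real n)\<^sup>2 \<le> dispersion n y"
    and S: "\<bar>score \<theta> \<beta> n y\<bar> \<le> \<kappa> * n" and S': "\<bar>score \<theta>' \<beta>' n y\<bar> \<le> \<kappa> * n"
    and Q: "precision n y * (centred_score \<theta> \<beta> n y)\<^sup>2 \<le> \<kappa>\<^sup>2 * n"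
    and Q': "precision n y * (centred_score \<theta>' \<beta>' n y)\<^sup>2 \<le> \<kappa>\<^sup>2 * n"
  shows "\<bar>\<theta>' - \<theta>\<bar> \<le> 2 * \<kappa>\<^sub>2 / sqrt (\<delta> * n)" and "\<bar>\<beta>' - \<beta>\<bar> \<le> 6 * \<kappa>\<^sub>2 / sqrt (\<delta> * n)"
proof -
  define V v u \<eta> where "V = dispersion n y" and "v = \<theta>' - \<theta>"
    and "u = \<beta>' - \<beta> + (\<theta>' - \<theta>) * (2 * avg n y / (real n - 1))"
    and "\<eta> = 1 - tanh (\<bar>\<beta>\<bar> + 2 * \<theta>)"
  define \<sigma> s A B W where "\<sigma> = sqrt (V / n)" and "s = sqrt (\<delta> * n)" and "A = n * \<bar>u\<bar>"
    and "B = \<bar>v\<bar> * \<sigma>" and "W = \<bar>u\<bar> + 4 * \<bar>v\<bar>"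
  have N: "real n \<ge> 12" using n by simp
  have n2: "n \<ge> 2" and n1: "n \<ge> 1" using n by auto
  have \<eta>: "\<eta> > 0" using tanh_real_lt_1 by (simp add: \<eta>_def)
  have s: "s \<ge> 8" using n\<delta> real_sqrt_le_mono[OF n\<delta>] by (simp add: s_def)
  have V0: "V \<ge> 0" using dispersion_nonneg[OF y] by (simp add: V_def)
  have "\<delta> * n \<le> V / n" using disp N by (simp add: V_def field_simps power2_eq_square)
  then have \<sigma>: "s \<le> \<sigma>" unfolding \<sigma>_def s_def by (rule real_sqrt_le_mono)
  have \<sigma>2: "\<sigma>\<^sup>2 = V / n" using V0 by (simp add: \<sigma>_def)
  have A0: "A \<ge> 0" and B0: "B \<ge> 0" using \<sigma> s by (auto simp: A_def B_def)
  have \<kappa>1: "\<kappa>\<^sub>1 \<ge> 0" using \<kappa> \<delta> by (simp add: \<kappa>\<^sub>1_def)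
  have \<kappa>2: "\<kappa>\<^sub>2 \<ge> 0" using \<kappa>1 \<eta> by (simp add: \<kappa>\<^sub>2_def \<eta>_def)
  have cs: "\<bar>q\<bar> \<le> \<kappa> * sqrt (2 / \<delta>) * (n * \<sigma>)" if "precision n y * q\<^sup>2 \<le> \<kappa>\<^sup>2 * n" for q
  proof -
    have "\<delta> * V \<le> 1 * V" using \<delta> V0 by (intro mult_right_mono) auto
    then have "V + (real n)\<^sup>2 \<le> 2 / \<delta> * V"
      using disp \<delta> by (simp add: V_def field_simps)
    then have "\<kappa>\<^sup>2 * n * (V + (real n)\<^sup>2) \<le> \<kappa>\<^sup>2 * n * (2 / \<delta> * V)"
      by (intro mult_left_mono) auto
    also have "\<dots> = (\<kappa> * sqrt (2 / \<delta>) * (n * \<sigma>))\<^sup>2"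
      using N \<delta> by (simp add: power_mult_distrib \<sigma>2) (simp add: power2_eq_square)
    finally have "q\<^sup>2 \<le> (\<kappa> * sqrt (2 / \<delta>) * (n * \<sigma>))\<^sup>2"
      using centred_score_le_of_precision[OF y n1 that] unfolding V_def by linarith
    moreover have "\<kappa> * sqrt (2 / \<delta>) * (n * \<sigma>) \<ge> 0" using \<kappa> \<delta> \<sigma> s by simp
    ultimately show ?thesis by (simp flip: abs_le_square_iff)
  qed
  have quad: "(A\<^sup>2 + B\<^sup>2) / 4 \<le> offsum n (\<lambda>i j. (u + v / (real n - 1) * coef n y i j)\<^sup>2)"
  proof -
    have "(u + k * c)\<^sup>2 = u\<^sup>2 + 2 * u * k * c + k\<^sup>2 * c\<^sup>2" for k c :: real
      by (simp add: power2_eq_square algebra_simps)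
    then have eq: "offsum n (\<lambda>i j. (u + v / (real n - 1) * coef n y i j)\<^sup>2) =
       real n * (real n - 1) * u\<^sup>2 + 2 * u * (v / (real n - 1)) * (- 2 * real n * avg n y)
        + (v / (real n - 1))\<^sup>2 * ((2 * real n - 12) * V + 4 * real n * (real n - 1))"
      by (simp only: offsum_add offsum_cmult offsum_const offsum_coef[OF y n2] offsum_coef_sq[OF y n2] V_def)
    have "A\<^sup>2 / 2 = real n * (real n / 2) * u\<^sup>2" by (simp add: A_def power_mult_distrib power2_eq_square)
    also have "\<dots> \<le> real n * (real n - 1) * u\<^sup>2" using N by (intro mult_right_mono mult_left_mono) auto
    finally have 1: "A\<^sup>2 / 2 \<le> real n * (real n - 1) * u\<^sup>2" .
    define Y where "Y = 2 * n * u * v * (2 * avg n y / (real n - 1))"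
    have Y: "2 * u * (v / (real n - 1)) * (- 2 * real n * avg n y) = - Y"
      by (simp add: Y_def)
    have "\<bar>Y\<bar> \<le> 2 * n * \<bar>u\<bar> * \<bar>v\<bar> * 2"
      unfolding Y_def abs_mult using avg_frac_le[OF y n2] by (intro mult_mono) auto
    also have "\<dots> = 2 * ((A / 2) * (4 * \<bar>v\<bar>))" by (simp add: A_def)
    also have "\<dots> \<le> (A / 2)\<^sup>2 + (4 * \<bar>v\<bar>)\<^sup>2" using sum_squares_bound[of "A / 2" "4 * \<bar>v\<bar>"] by simp
    also have "\<dots> \<le> A\<^sup>2 / 4 + B\<^sup>2 / 4"
    proof -
      \<comment> \<open>The assumption \<open>64 \<le> \<delta> * n\<close> gives
        \<open>s \<ge> 8\<close>, which makes the cross term harmless.\<close>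
      have "8 * \<bar>v\<bar> \<le> B" unfolding B_def using \<sigma> s by (subst mult.commute) (intro mult_left_mono, auto)
      then have "(8 * \<bar>v\<bar>)\<^sup>2 \<le> B\<^sup>2" by (intro power_mono) auto
      then show ?thesis by (simp add: power_mult_distrib power_divide)
    qed
    finally have 2: "- (A\<^sup>2 / 4 + B\<^sup>2 / 4) \<le> 2 * u * (v / (real n - 1)) * (- 2 * real n * avg n y)"
      unfolding Y by linarith
    have "B\<^sup>2 = (v / n)\<^sup>2 * (n * V)"
      using N by (simp add: B_def power_mult_distrib \<sigma>2 power_divide) (simp add: power2_eq_square)
    also have "\<dots> \<le> (v / (real n - 1))\<^sup>2 * (n * V)"
      unfolding power_divide using N V0
      by (intro mult_right_mono divide_left_mono power_mono) auto
    \<comment> \<open>\<open>2 * n - 12 \<ge> n\<close> is where \<open>n \<ge> 12\<close>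
      enters.\<close>
    also have "\<dots> \<le> (v / (real n - 1))\<^sup>2 * ((2 * real n - 12) * V + 4 * real n * (real n - 1))"
      using N V0 by (intro mult_left_mono add_increasing2 mult_right_mono) auto
    finally have 3: "B\<^sup>2 \<le> (v / (real n - 1))\<^sup>2 * ((2 * real n - 12) * V + 4 * real n * (real n - 1))" .
    have "(a + b) / 4 \<le> k + l + m"
      if "a / 2 \<le> k" "- (a / 4 + b / 4) \<le> l" "b \<le> m" "0 \<le> b" for a b k l m :: real
      using that unfolding add_divide_distrib by linarith
    from this[OF 1 2 3] show ?thesis unfolding eq by simp
  qed
  have lin: "u * (score \<theta> \<beta> n y - score \<theta>' \<beta>' n y) + v / (real n - 1) * (centred_score \<theta> \<beta> n y - centred_score \<theta>' \<beta>' n y)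
     \<le> \<kappa>\<^sub>1 * (A + B)"
  proof -
    have "u * (score \<theta> \<beta> n y - score \<theta>' \<beta>' n y) \<le> \<bar>u\<bar> * \<bar>score \<theta> \<beta> n y - score \<theta>' \<beta>' n y\<bar>"
      by (metis abs_ge_self abs_mult)
    also have "\<dots> \<le> \<bar>u\<bar> * (2 * (\<kappa> * n))" using S S' by (intro mult_left_mono) auto
    finally have 1: "u * (score \<theta> \<beta> n y - score \<theta>' \<beta>' n y) \<le> 2 * \<kappa> * A" by (simp add: A_def mult_ac)
    let ?z = "\<kappa> * sqrt (2 / \<delta>) * (n * \<sigma>)"
    have z0: "?z \<ge> 0" using \<kappa> \<delta> \<sigma> s by simp
    have "v / (real n - 1) * (centred_score \<theta> \<beta> n y - centred_score \<theta>' \<beta>' n y)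
       \<le> \<bar>v / (real n - 1)\<bar> * \<bar>centred_score \<theta> \<beta> n y - centred_score \<theta>' \<beta>' n y\<bar>"
      by (metis abs_ge_self abs_mult)
    also have "\<dots> \<le> (2 * \<bar>v\<bar> / n) * (2 * ?z)"
    proof (intro mult_mono)
      show "\<bar>v / (real n - 1)\<bar> \<le> 2 * \<bar>v\<bar> / n"
        using N mult_right_mono[of "real n" "2 * (real n - 1)" "\<bar>v\<bar>"] by (simp add: abs_divide field_simps)
      show "\<bar>centred_score \<theta> \<beta> n y - centred_score \<theta>' \<beta>' n y\<bar> \<le> 2 * ?z"
        using cs[OF Q] cs[OF Q'] by (simp add: abs_le_iff)
    qed auto
    also have "\<dots> = 4 * \<kappa> * sqrt (2 / \<delta>) * B" using N by (simp add: B_def)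
    finally have 2: "v / (real n - 1) * (centred_score \<theta> \<beta> n y - centred_score \<theta>' \<beta>' n y) \<le> 4 * \<kappa> * sqrt (2 / \<delta>) * B" .
    have "0 \<le> 4 * \<kappa> * sqrt (2 / \<delta>) * A" "0 \<le> 2 * \<kappa> * B" using \<kappa> \<delta> A0 B0 by auto
    then have "2 * \<kappa> * A + 4 * \<kappa> * sqrt (2 / \<delta>) * B \<le> \<kappa>\<^sub>1 * (A + B)"
      unfolding \<kappa>\<^sub>1_def by (simp add: algebra_simps)
    then show ?thesis using 1 2 by linarith
  qed
  define T where "T = A + B"
  have W0: "W \<ge> 0" by (simp add: W_def)
  have T0: "T \<ge> 0" using A0 B0 by (simp add: T_def)
  have "\<eta> / (1 + W) * ((A\<^sup>2 + B\<^sup>2) / 4) \<le> \<kappa>\<^sub>1 * T"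
  proof -
    have "\<eta> / (1 + W) * ((A\<^sup>2 + B\<^sup>2) / 4) \<le> \<eta> / (1 + W) * offsum n (\<lambda>i j. (u + v / (real n - 1) * coef n y i j)\<^sup>2)"
      using quad \<eta> W0 by (intro mult_left_mono) auto
    also have "\<dots> \<le> \<kappa>\<^sub>1 * T"
      using score_difference_ge[OF y n2 \<theta>, of \<beta> \<beta>' \<theta>'] lin unfolding u_def v_def \<eta>_def W_def T_def by linarith
    finally show ?thesis .
  qed
  moreover have "T\<^sup>2 / 8 \<le> (A\<^sup>2 + B\<^sup>2) / 4"
    using zero_le_power2[of "A - B"] by (simp add: T_def power2_eq_square algebra_simps)
  then have "\<eta> / (1 + W) * (T\<^sup>2 / 8) \<le> \<eta> / (1 + W) * ((A\<^sup>2 + B\<^sup>2) / 4)"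
    using \<eta> W0 by (intro mult_left_mono) auto
  ultimately have "\<eta> / (1 + W) * (T\<^sup>2 / 8) \<le> \<kappa>\<^sub>1 * T" by linarith
  \<comment> \<open>The 8 in \<open>\<kappa>\<^sub>2\<close> is the one of
    \<open>T\<^sup>2 / 8\<close>.\<close>
  then have "T * T \<le> T * (\<kappa>\<^sub>2 * (1 + W))"
    unfolding \<kappa>\<^sub>2_def \<eta>_def[symmetric] using \<eta> W0 by (simp add: field_simps power2_eq_square)
  then have T1: "T \<le> \<kappa>\<^sub>2 * (1 + W)"
    using T0 \<kappa>2 W0 by (cases "T = 0") (auto simp: mult_le_cancel_left)
  have sn: "s \<le> n"
  proof -
    have "\<delta> * n \<le> 1 * real n" using \<delta> by (intro mult_right_mono) auto
    also have "\<dots> \<le> real n * n" using N by (intro mult_right_mono) auto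
    finally show ?thesis unfolding s_def by (intro real_le_lsqrt) (auto simp: power2_eq_square)
  qed
  have u: "\<bar>u\<bar> \<le> A / s" and v: "\<bar>v\<bar> \<le> B / s"
  proof -
    have "\<bar>u\<bar> * s \<le> \<bar>u\<bar> * n" using sn by (intro mult_left_mono) auto
    then show "\<bar>u\<bar> \<le> A / s" using s by (simp add: A_def field_simps)
    have "\<bar>v\<bar> * s \<le> \<bar>v\<bar> * \<sigma>" using \<sigma> by (intro mult_left_mono) auto
    then show "\<bar>v\<bar> \<le> B / s" using s by (simp add: B_def field_simps)
  qed
  have "W \<le> A / s + 4 * (B / s)" using u v by (simp add: W_def)
  also have "\<dots> \<le> 4 * (A / s) + 4 * (B / s)" using A0 s by (simp add: field_simps)
  also have "\<dots> = 4 * T / s" by (simp add: T_def add_divide_distrib)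
  finally have "\<kappa>\<^sub>2 * W \<le> \<kappa>\<^sub>2 * (4 * T / s)" using \<kappa>2 by (intro mult_left_mono) auto
  also have "\<dots> = (8 * \<kappa>\<^sub>2) * T / (2 * s)" by simp
  also have "\<dots> \<le> s * T / (2 * s)"
    using large s T0 unfolding s_def[symmetric] by (intro divide_right_mono mult_right_mono) auto
  also have "\<dots> = T / 2" using s by simp
  finally have "T \<le> 2 * \<kappa>\<^sub>2" using T1 by (simp add: distrib_left)
  then have AB: "A \<le> 2 * \<kappa>\<^sub>2" "B \<le> 2 * \<kappa>\<^sub>2" using A0 B0 by (auto simp: T_def)
  have "A / s \<le> 2 * \<kappa>\<^sub>2 / s" "B / s \<le> 2 * \<kappa>\<^sub>2 / s"
    using AB s by (auto intro: divide_right_mono)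
  then have us: "\<bar>u\<bar> \<le> 2 * \<kappa>\<^sub>2 / s" and vs: "\<bar>v\<bar> \<le> 2 * \<kappa>\<^sub>2 / s"
    using u v by linarith+
  show "\<bar>\<theta>' - \<theta>\<bar> \<le> 2 * \<kappa>\<^sub>2 / sqrt (\<delta> * n)" using vs by (simp add: v_def s_def)
  have "\<bar>v * (2 * avg n y / (real n - 1))\<bar> \<le> \<bar>v\<bar> * 2"
    unfolding abs_mult[of v] using avg_frac_le[OF y n2] by (intro mult_left_mono) auto
  moreover have "\<beta>' - \<beta> = u - v * (2 * avg n y / (real n - 1))" by (simp add: u_def v_def)
  \<comment> \<open>\<open>3 = 1 + 2\<close>: one share from u, two from v times the mean field,
    which is at most 2 in absolute value.\<close>
  moreover have "\<bar>d\<bar> \<le> 3 * k" if "\<bar>x\<bar> \<le> \<bar>v\<bar> * 2" "d = u - x" "\<bar>u\<bar> \<le> k" "\<bar>v\<bar> \<le> k" for d x k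
    using that by linarith
  ultimately have "\<bar>\<beta>' - \<beta>\<bar> \<le> 3 * (2 * \<kappa>\<^sub>2 / s)" using us vs by blast
  then show "\<bar>\<beta>' - \<beta>\<bar> \<le> 6 * \<kappa>\<^sub>2 / sqrt (\<delta> * n)" by (simp add: s_def)
qed

section \<open>Consistency of the estimators\<close>

text \<open>Tightness concerns all n. For each of the finitely many small n there are finitely many
  graphs, so a single constant bounds X there.\<close>

lemma two_star_bounded_in_probI:
  fixes X :: "nat \<Rightarrow> adjacency \<Rightarrow> 'a::euclidean_space"
  assumes "\<And>\<epsilon>. \<epsilon> > 0 \<Longrightarrow> \<exists>B n\<^sub>0. \<forall>n\<ge>n\<^sub>0. measure_pmf.prob (two_star \<theta> \<beta> n) {g. norm (X n g) > B} < \<epsilon>"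
  shows "bounded_in_prob (two_star \<theta> \<beta>) X"
  unfolding bounded_in_prob_iff_norm
proof (intro allI impI)
  fix \<epsilon> :: real assume \<epsilon>: "\<epsilon> > 0"
  then obtain B n\<^sub>0 where B: "\<And>n. n \<ge> n\<^sub>0 \<Longrightarrow> measure_pmf.prob (two_star \<theta> \<beta> n) {g. norm (X n g) > B} < \<epsilon>"
    using assms by blast
  define M where "M = (\<Sum>n<n\<^sub>0. \<Sum>g\<in>graphs n. norm (X n g))"
  have "measure_pmf.prob (two_star \<theta> \<beta> n) {g. norm (X n g) > max B M} < \<epsilon>" for n
  proof (cases "n \<ge> n\<^sub>0")
    case True
    have "measure_pmf.prob (two_star \<theta> \<beta> n) {g. norm (X n g) > max B M}
        \<le> measure_pmf.prob (two_star \<theta> \<beta> n) {g. norm (X n g) > B}"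
      by (intro measure_pmf.finite_measure_mono) auto
    then show ?thesis using B[OF True] by linarith
  next
    case False
    have "norm (X n g) \<le> M" if "g \<in> set_pmf (two_star \<theta> \<beta> n)" for g
    proof -
      have "norm (X n g) \<le> (\<Sum>g\<in>graphs n. norm (X n g))"
        using that set_pmf_two_star by (intro member_le_sum finite_graphs) auto
      also have "\<dots> \<le> M" unfolding M_def
        using False by (intro member_le_sum[of n "{..<n\<^sub>0}" "\<lambda>n. \<Sum>g\<in>graphs n. norm (X n g)"] sum_nonneg) auto
      finally show ?thesis .
    qed
    then have "set_pmf (two_star \<theta> \<beta> n) \<inter> {g. norm (X n g) > max B M} = {}" by force
    then have "measure_pmf.prob (two_star \<theta> \<beta> n) {g. norm (X n g) > max B M} = 0"
      unfolding measure_pmf_zero_iff .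
    then show ?thesis using \<epsilon> by (simp only:)
  qed
  then show "\<exists>B. \<forall>n. measure_pmf.prob (two_star \<theta> \<beta> n) {g. norm (X n g) > B} < \<epsilon>" by blast
qed

text \<open>
  Solutions of the score equations need not exist. Rounding the discrepancies down to natural
  numbers guarantees a minimiser, at the price of an additive error of 1.
\<close>

definition score_disc :: "real \<Rightarrow> real \<Rightarrow> nat \<Rightarrow> (nat \<Rightarrow> nat \<Rightarrow> real) \<Rightarrow> real" where
  "score_disc \<theta> \<beta> n y = (score \<theta> \<beta> n y)\<^sup>2 / (real n)\<^sup>2"

definition joint_disc :: "real \<Rightarrow> real \<Rightarrow> nat \<Rightarrow> (nat \<Rightarrow> nat \<Rightarrow> real) \<Rightarrow> real" where
  "joint_disc \<theta> \<beta> n y = score_disc \<theta> \<beta> n y + precision n y * (centred_score \<theta> \<beta> n y)\<^sup>2 / real n"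

definition joint_estimator :: "nat \<Rightarrow> adjacency \<Rightarrow> real \<times> real" where
  "joint_estimator n g = arg_min (\<lambda>(\<theta>, \<beta>). nat \<lfloor>joint_disc \<theta> \<beta> n (spin n g)\<rfloor>) (\<lambda>_. True)"

definition beta_estimator :: "real \<Rightarrow> nat \<Rightarrow> adjacency \<Rightarrow> real" where
  "beta_estimator \<theta> n g = arg_min (\<lambda>\<beta>. nat \<lfloor>score_disc \<theta> \<beta> n (spin n g)\<rfloor>) (\<lambda>_. True)"

lemma arg_min_nat_floor_le:
  fixes f :: "'a \<Rightarrow> real"
  assumes "\<And>p. f p \<ge> 0"
  shows "f (arg_min (\<lambda>p. nat \<lfloor>f p\<rfloor>) (\<lambda>_. True)) \<le> f q + 1"
proof -
  have "nat \<lfloor>f (arg_min (\<lambda>p. nat \<lfloor>f p\<rfloor>) (\<lambda>_. True))\<rfloor> \<le> nat \<lfloor>f q\<rfloor>"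
    by (rule arg_min_nat_le) simp
  \<comment> \<open>Nonnegativity matters: \<open>nat\<close> would identify all negative
    floors.\<close>
  then have "\<lfloor>f (arg_min (\<lambda>p. nat \<lfloor>f p\<rfloor>) (\<lambda>_. True))\<rfloor> \<le> \<lfloor>f q\<rfloor>"
    using assms by (simp add: nat_le_eq_zle)
  then show ?thesis by linarith
qed

lemma score_disc_nonneg: "score_disc \<theta> \<beta> n y \<ge> 0"
  by (simp add: score_disc_def)

lemma score_disc_le_joint_disc: "spins n y \<Longrightarrow> score_disc \<theta> \<beta> n y \<le> joint_disc \<theta> \<beta> n y"
  using dispersion_nonneg[of n y] by (simp add: joint_disc_def precision_def)

lemma joint_disc_nonneg: "spins n y \<Longrightarrow> joint_disc \<theta> \<beta> n y \<ge> 0"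
  using score_disc_nonneg score_disc_le_joint_disc by (rule order_trans)

lemma joint_disc_estimator_le:
  assumes "g \<in> graphs n"
  shows "joint_disc (fst (joint_estimator n g)) (snd (joint_estimator n g)) n (spin n g)
    \<le> joint_disc \<theta> \<beta> n (spin n g) + 1"
proof -
  let ?f = "\<lambda>(\<theta>, \<beta>). joint_disc \<theta> \<beta> n (spin n g)"
  have "?f p \<ge> 0" for p
    using joint_disc_nonneg[OF spins_spin[OF assms]] by (simp split: prod.split)
  from arg_min_nat_floor_le[of ?f, OF this, where q = "(\<theta>, \<beta>)"]
  show ?thesis by (simp add: joint_estimator_def case_prod_unfold)
qed

lemma score_disc_estimator_le:
  "score_disc \<theta> (beta_estimator \<theta> n g) n (spin n g) \<le> score_disc \<theta> \<beta> n (spin n g) + 1"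
  unfolding beta_estimator_def by (rule arg_min_nat_floor_le) (rule score_disc_nonneg)

lemma abs_score_le_of_disc:
  assumes "score_disc \<theta> \<beta> n y \<le> \<kappa>\<^sup>2" "n \<ge> 1" "\<kappa> \<ge> 0"
  shows "\<bar>score \<theta> \<beta> n y\<bar> \<le> \<kappa> * n"
proof -
  have "(score \<theta> \<beta> n y)\<^sup>2 \<le> (\<kappa> * n)\<^sup>2"
    using assms by (simp add: score_disc_def power_mult_distrib field_simps)
  then show ?thesis using assms by (simp flip: abs_le_square_iff)
qed

lemma centred_score_le_of_disc:
  assumes "joint_disc \<theta> \<beta> n y \<le> \<kappa>\<^sup>2" "n \<ge> 1"
  shows "precision n y * (centred_score \<theta> \<beta> n y)\<^sup>2 \<le> \<kappa>\<^sup>2 * n"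
proof -
  have "precision n y * (centred_score \<theta> \<beta> n y)\<^sup>2 / n \<le> \<kappa>\<^sup>2"
    using assms score_disc_nonneg[of \<theta> \<beta> n y] unfolding joint_disc_def by linarith
  then show ?thesis using assms by (simp add: field_simps)
qed

lemma expect_score_disc_le:
  assumes "\<theta> \<ge> 0" "n \<ge> 1"
  shows "expect \<theta> \<beta> n (score_disc \<theta> \<beta> n) \<le> 4 + 16 * \<theta>"
proof -
  have "expect \<theta> \<beta> n (score_disc \<theta> \<beta> n) = 1 / (real n)\<^sup>2 * expect \<theta> \<beta> n (\<lambda>y. (score \<theta> \<beta> n y)\<^sup>2)"
    unfolding expect_cmult[symmetric] by (simp add: score_disc_def[abs_def])
  also have "\<dots> \<le> 1 / (real n)\<^sup>2 * ((4 + 16 * \<theta>) * (real n)\<^sup>2)"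
    using assms by (intro mult_left_mono expect_score_sq_le) auto
  finally show ?thesis using assms by simp
qed

lemma expect_joint_disc_le:
  assumes "\<theta> \<ge> 0" "n \<ge> 2"
  shows "expect \<theta> \<beta> n (joint_disc \<theta> \<beta> n) \<le> 4 + 16 * \<theta> + centred_score_const \<theta>"
proof -
  have "expect \<theta> \<beta> n (joint_disc \<theta> \<beta> n) = expect \<theta> \<beta> n (score_disc \<theta> \<beta> n) +
      1 / n * expect \<theta> \<beta> n (\<lambda>y. precision n y * (centred_score \<theta> \<beta> n y)\<^sup>2)"
    unfolding expect_cmult[symmetric] expect_add[symmetric] by (simp add: joint_disc_def[abs_def])
  also have "\<dots> \<le> (4 + 16 * \<theta>) + 1 / n * (centred_score_const \<theta> * n)"
    using assms by (intro add_mono mult_left_mono expect_score_disc_le expect_centred_score_sq_le) auto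
  finally show ?thesis using assms by simp
qed

text \<open>Markov's inequality combined with a deterministic implication; the last assumption is
  where the identifiability estimates enter.\<close>

lemma prob_gt_le_expect:
  assumes "\<And>y. spins n y \<Longrightarrow> 0 \<le> F y" and "K > 0" and "expect \<theta> \<beta> n F \<le> C"
    and "\<And>g. g \<in> graphs n \<Longrightarrow> F (spin n g) \<le> K \<Longrightarrow> norm (X g) \<le> B"
  shows "measure_pmf.prob (two_star \<theta> \<beta> n) {g. norm (X g) > B} \<le> C / K"
proof -
  have "measure_pmf.prob (two_star \<theta> \<beta> n) {g. norm (X g) > B}
      = measure_pmf.prob (two_star \<theta> \<beta> n) ({g. norm (X g) > B} \<inter> graphs n)"
    using set_pmf_two_star[of \<theta> \<beta> n] by (intro measure_prob_cong_0) (auto simp: set_pmf_iff)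
  also have "\<dots> \<le> measure_pmf.prob (two_star \<theta> \<beta> n) {g. K \<le> F (spin n g)}"
    using assms(4) by (intro measure_pmf.finite_measure_mono) force+
  also have "\<dots> \<le> expect \<theta> \<beta> n F / K"
    by (rule prob_le_expect[OF assms(1,2)])
  also have "\<dots> \<le> C / K" using assms(2,3) by (intro divide_right_mono) auto
  finally show ?thesis .
qed

text \<open>For fixed \<theta> we have \<open>v = 0\<close>, so the quadratic form is exactly
  \<open>n * (n - 1) * u^2\<close> and a score of order n gives the rate n.\<close>

lemma beta_estimate_close:
  fixes \<theta> \<beta> \<beta>' \<kappa> :: real
  defines "\<eta> \<equiv> 1 - tanh (\<bar>\<beta>\<bar> + 2 * \<theta>)"
  assumes y: "spins n y" and n: "n \<ge> 2" and \<theta>: "\<theta> \<ge> 0" and large: "8 * \<kappa> / \<eta> \<le> n"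
    and S: "\<bar>score \<theta> \<beta> n y\<bar> \<le> \<kappa> * n" and S': "\<bar>score \<theta> \<beta>' n y\<bar> \<le> \<kappa> * n"
  shows "n * \<bar>\<beta>' - \<beta>\<bar> \<le> 8 * \<kappa> / \<eta>"
proof (cases "\<beta>' = \<beta>")
  case True
  have "\<kappa> * n \<ge> 0" using S by linarith
  then have "\<kappa> \<ge> 0" using n by (simp add: zero_le_mult_iff)
  moreover have "\<eta> > 0" using tanh_real_lt_1 by (simp add: \<eta>_def)
  ultimately show ?thesis using True by simp
next
  case False
  define u where "u = \<beta>' - \<beta>"
  have u: "\<bar>u\<bar> > 0" using False by (simp add: u_def)
  have \<eta>: "\<eta> > 0" using tanh_real_lt_1 by (simp add: \<eta>_def)
  have N: "real n \<ge> 2" using n by simp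
  have "\<eta> / (1 + \<bar>u\<bar>) * (real n * (real n - 1) * u\<^sup>2) \<le> u * (score \<theta> \<beta> n y - score \<theta> \<beta>' n y)"
    using score_difference_ge[OF y n \<theta>, of \<beta> \<beta>' \<theta>] by (simp add: offsum_const \<eta>_def u_def)
  also have "\<dots> \<le> \<bar>u\<bar> * \<bar>score \<theta> \<beta> n y - score \<theta> \<beta>' n y\<bar>" by (metis abs_ge_self abs_mult)
  also have "\<dots> \<le> \<bar>u\<bar> * (2 * (\<kappa> * n))" using S S' by (intro mult_left_mono) auto
  finally have 1: "\<eta> / (1 + \<bar>u\<bar>) * (real n * (real n - 1) * u\<^sup>2) \<le> \<bar>u\<bar> * (2 * (\<kappa> * n))" .
  have "\<eta> / (1 + \<bar>u\<bar>) * (real n * (real n / 2) * u\<^sup>2) \<le> \<eta> / (1 + \<bar>u\<bar>) * (real n * (real n - 1) * u\<^sup>2)"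
    using \<eta> N by (intro mult_left_mono mult_right_mono) auto
  also note 1
  also have "\<eta> / (1 + \<bar>u\<bar>) * (real n * (real n / 2) * u\<^sup>2) = (\<bar>u\<bar> * n) * (\<eta> / (1 + \<bar>u\<bar>) * (n / 2 * \<bar>u\<bar>))"
    unfolding power2_abs[of u, symmetric] power2_eq_square by simp
  also have "\<bar>u\<bar> * (2 * (\<kappa> * n)) = (\<bar>u\<bar> * n) * (2 * \<kappa>)" by simp
  finally have "\<eta> / (1 + \<bar>u\<bar>) * (n / 2 * \<bar>u\<bar>) \<le> 2 * \<kappa>"
    using u N by (subst (asm) mult_le_cancel_left_pos) auto
  then have "\<eta> * n * \<bar>u\<bar> \<le> 4 * \<kappa> * (1 + \<bar>u\<bar>)"
    using \<eta> by (simp add: field_simps)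
  \<comment> \<open>Half of the left-hand side absorbs the term with |u| caused by the denominator
    \<open>1 + \<bar>u\<bar>\<close>.\<close>
  moreover have "8 * \<kappa> \<le> \<eta> * n" using large \<eta> by (simp add: field_simps)
  then have "8 * \<kappa> * \<bar>u\<bar> \<le> \<eta> * n * \<bar>u\<bar>" by (intro mult_right_mono) auto
  ultimately have "\<eta> * n * \<bar>u\<bar> \<le> 8 * \<kappa>" unfolding distrib_left by linarith
  then show ?thesis using \<eta> by (simp add: u_def field_simps)
qed

lemma beta_estimator_bounded:
  assumes \<theta>: "\<theta> > 0"
  shows "bounded_in_prob (two_star \<theta> \<beta>) (\<lambda>n g. real n * (beta_estimator \<theta> n g - \<beta>))"
proof (rule two_star_bounded_in_probI)
  fix \<epsilon> :: real assume \<epsilon>: "\<epsilon> > 0"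
  define C where "C = 4 + 16 * \<theta>"
  \<comment> \<open>Markov's inequality will give probability at most
    \<open>C / K = \<epsilon> / 2\<close>.\<close>
  define K where "K = 2 * C / \<epsilon>"
  \<comment> \<open>The 1 pays for the rounding in the estimator: the same bound then holds at the
    true and at the estimated parameter.\<close>
  define \<kappa> where "\<kappa> = sqrt (K + 1)"
  define B where "B = 8 * \<kappa> / (1 - tanh (\<bar>\<beta>\<bar> + 2 * \<theta>))"
  have C: "C > 0" using \<theta> by (simp add: C_def)
  have K: "K > 0" using C \<epsilon> by (simp add: K_def)
  have \<kappa>: "\<kappa>\<^sup>2 = K + 1" "\<kappa> \<ge> 0" using K by (auto simp: \<kappa>_def)
  have "measure_pmf.prob (two_star \<theta> \<beta> n) {g. norm (real n * (beta_estimator \<theta> n g - \<beta>)) > B} < \<epsilon>"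
    if n: "n \<ge> max 2 (nat \<lceil>B\<rceil>)" for n
  proof -
    have n': "n \<ge> 2" "n \<ge> 1" "B \<le> n" using n by (auto simp: nat_le_iff ceiling_le_iff)
    have "measure_pmf.prob (two_star \<theta> \<beta> n) {g. norm (real n * (beta_estimator \<theta> n g - \<beta>)) > B} \<le> C / K"
    proof (rule prob_gt_le_expect[OF score_disc_nonneg K])
      show "expect \<theta> \<beta> n (score_disc \<theta> \<beta> n) \<le> C"
        using \<theta> n' unfolding C_def by (intro expect_score_disc_le) auto
      fix g assume g: "g \<in> graphs n" and le: "score_disc \<theta> \<beta> n (spin n g) \<le> K"
      have S: "\<bar>score \<theta> \<beta> n (spin n g)\<bar> \<le> \<kappa> * n"
        using le \<kappa> n' by (intro abs_score_le_of_disc) auto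
      have S': "\<bar>score \<theta> (beta_estimator \<theta> n g) n (spin n g)\<bar> \<le> \<kappa> * n"
        using le \<kappa> n' score_disc_estimator_le[of \<theta> n g \<beta>] by (intro abs_score_le_of_disc) auto
      show "norm (real n * (beta_estimator \<theta> n g - \<beta>)) \<le> B"
        using beta_estimate_close[OF spins_spin[OF g] n'(1) _ _ S S'] \<theta> n'(3) by (simp add: B_def abs_mult)
    qed
    also have "C / K < \<epsilon>" using C \<epsilon> by (simp add: K_def)
    finally show ?thesis .
  qed
  then show "\<exists>B n\<^sub>0. \<forall>n\<ge>n\<^sub>0. measure_pmf.prob (two_star \<theta> \<beta> n) {g. norm (real n * (beta_estimator \<theta> n g - \<beta>)) > B} < \<epsilon>"
    by blast
qed

lemma joint_estimator_bounded:
  assumes \<theta>: "\<theta> > 0"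
  shows "bounded_in_prob (two_star \<theta> \<beta>)
    (\<lambda>n g. sqrt (real n) *\<^sub>R (fst (joint_estimator n g) - \<theta>, snd (joint_estimator n g) - \<beta>))"
proof (rule two_star_bounded_in_probI)
  fix \<epsilon> :: real assume \<epsilon>: "\<epsilon> > 0"
  define C where "C = 4 + 16 * \<theta> + centred_score_const \<theta>"
  define K where "K = 2 * C / \<epsilon>"
  define \<kappa> where "\<kappa> = sqrt (K + 1)"
  define \<eta> where "\<eta> = 1 - tanh (\<bar>\<beta>\<bar> + 2 * \<theta>)"
  define \<delta> where "\<delta> = \<eta> / (4 * (1 + \<theta>))"
  define \<kappa>\<^sub>2 where "\<kappa>\<^sub>2 = 8 * (2 * \<kappa> + 4 * \<kappa> * sqrt (2 / \<delta>)) / \<eta>"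
  define B where "B = 8 * \<kappa>\<^sub>2 / sqrt \<delta>"
  \<comment> \<open>The sum of all thresholds on \<open>n\<close> and \<open>sqrt n\<close>. As
    \<open>L \<ge> 1\<close>, the condition \<open>L\<^sup>2 \<le> n\<close> gives both
    \<open>L \<le> sqrt n\<close> and \<open>L \<le> n\<close>.\<close>
  define L where "L = 1 + 12 + 64 / \<delta> + 2 * (4 * \<theta> + 2 * \<kappa>) / \<eta> + 8 * \<kappa>\<^sub>2 / sqrt \<delta>"
  have C: "C > 0" using \<theta> by (auto simp: C_def centred_score_const_def intro!: add_pos_pos mult_pos_pos)
  have K: "K > 0" using C \<epsilon> by (simp add: K_def)
  have \<kappa>: "\<kappa>\<^sup>2 = K + 1" "\<kappa> \<ge> 0" using K by (auto simp: \<kappa>_def)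
  have \<eta>: "0 < \<eta>" "\<eta> \<le> 1" using tanh_real_lt_1 \<theta> by (auto simp: \<eta>_def)
  have \<delta>: "0 < \<delta>" "\<delta> \<le> 1" using \<eta> \<theta> by (auto simp: \<delta>_def field_simps)
  have \<kappa>2: "\<kappa>\<^sub>2 \<ge> 0" using \<kappa> \<eta> \<delta> by (simp add: \<kappa>\<^sub>2_def)
  have parts: "64 / \<delta> \<ge> 0" "2 * (4 * \<theta> + 2 * \<kappa>) / \<eta> \<ge> 0" "8 * \<kappa>\<^sub>2 / sqrt \<delta> \<ge> 0"
    using \<delta> \<eta> \<theta> \<kappa> \<kappa>2 by auto
  have "measure_pmf.prob (two_star \<theta> \<beta> n)
      {g. norm (sqrt (real n) *\<^sub>R (fst (joint_estimator n g) - \<theta>, snd (joint_estimator n g) - \<beta>)) > B} < \<epsilon>"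
    if n: "n \<ge> nat \<lceil>L\<^sup>2\<rceil>" for n
  proof -
    have "L\<^sup>2 \<le> n" using n by (simp add: nat_le_iff ceiling_le_iff)
    then have sL: "L \<le> sqrt n" by (rule real_le_rsqrt)
    have L1: "L \<ge> 1" using parts by (simp add: L_def)
    have "L \<le> L\<^sup>2" using L1 by (simp add: power2_eq_square)
    then have nL: "L \<le> n" using \<open>L\<^sup>2 \<le> n\<close> by linarith
    have n12: "n \<ge> 12" using nL parts unfolding L_def by linarith
    then have n': "n \<ge> 2" "n \<ge> 1" by auto
    have n\<delta>: "64 \<le> \<delta> * n"
    proof -
      have "64 / \<delta> \<le> n" using nL parts unfolding L_def by linarith
      then show ?thesis using \<delta> by (simp add: field_simps)
    qed
    have large1: "2 * (4 * \<theta> + 2 * \<kappa>) / \<eta> < sqrt n" using sL parts unfolding L_def by linarith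
    have large2: "8 * \<kappa>\<^sub>2 \<le> sqrt (\<delta> * n)"
    proof -
      have "8 * \<kappa>\<^sub>2 / sqrt \<delta> \<le> sqrt n" using sL parts unfolding L_def by linarith
      then show ?thesis using \<delta> by (simp add: real_sqrt_mult field_simps)
    qed
    have "measure_pmf.prob (two_star \<theta> \<beta> n)
      {g. norm (sqrt (real n) *\<^sub>R (fst (joint_estimator n g) - \<theta>, snd (joint_estimator n g) - \<beta>)) > B} \<le> C / K"
    proof (rule prob_gt_le_expect[OF joint_disc_nonneg K])
      show "expect \<theta> \<beta> n (joint_disc \<theta> \<beta> n) \<le> C"
        using \<theta> n' unfolding C_def by (intro expect_joint_disc_le) auto
      fix g assume g: "g \<in> graphs n" and le: "joint_disc \<theta> \<beta> n (spin n g) \<le> K"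
      define \<theta>' \<beta>' where "\<theta>' = fst (joint_estimator n g)" and "\<beta>' = snd (joint_estimator n g)"
      note y = spins_spin[OF g]
      have J: "joint_disc \<theta> \<beta> n (spin n g) \<le> \<kappa>\<^sup>2" "joint_disc \<theta>' \<beta>' n (spin n g) \<le> \<kappa>\<^sup>2"
        using le joint_disc_estimator_le[OF g, of \<theta> \<beta>] \<kappa> by (auto simp: \<theta>'_def \<beta>'_def)
      have S: "\<bar>score \<theta> \<beta> n (spin n g)\<bar> \<le> \<kappa> * n" "\<bar>score \<theta>' \<beta>' n (spin n g)\<bar> \<le> \<kappa> * n"
        using order_trans[OF score_disc_le_joint_disc[OF y] J(1)] order_trans[OF score_disc_le_joint_disc[OF y] J(2)]
          n' \<kappa>(2) by (auto intro!: abs_score_le_of_disc)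
      note Q = centred_score_le_of_disc[OF J(1) n'(2)] centred_score_le_of_disc[OF J(2) n'(2)]
      have disp: "\<delta> * (real n)\<^sup>2 \<le> dispersion n (spin n g)"
        using dispersion_ge[OF y n'(1) _ \<kappa>(2) _ Q(1)] large1 \<theta> by (simp add: \<delta>_def \<eta>_def)
      have close: "\<bar>\<theta>' - \<theta>\<bar> \<le> 2 * \<kappa>\<^sub>2 / sqrt (\<delta> * n)" "\<bar>\<beta>' - \<beta>\<bar> \<le> 6 * \<kappa>\<^sub>2 / sqrt (\<delta> * n)"
        using estimate_close[OF y n12 n\<delta> _ _ \<delta> \<kappa>(2) disp S Q] large2 \<theta>
        unfolding \<kappa>\<^sub>2_def \<eta>_def by simp_all
      have "norm (sqrt (real n) *\<^sub>R (\<theta>' - \<theta>, \<beta>' - \<beta>)) = sqrt n * norm (\<theta>' - \<theta>, \<beta>' - \<beta>)"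
        by (simp only: norm_scaleR) simp
      also have "\<dots> \<le> sqrt n * (\<bar>\<theta>' - \<theta>\<bar> + \<bar>\<beta>' - \<beta>\<bar>)"
        using norm_Pair_le[of "\<theta>' - \<theta>" "\<beta>' - \<beta>"] by (intro mult_left_mono) auto
      \<comment> \<open>\<open>8 = 2 + 6\<close>, from the two coordinates.\<close>
      also have "\<dots> \<le> sqrt n * (8 * \<kappa>\<^sub>2 / sqrt (\<delta> * n))"
        using close by (intro mult_left_mono) auto
      also have "\<dots> = B" using n' by (simp add: B_def real_sqrt_mult)
      finally show "norm (sqrt (real n) *\<^sub>R (fst (joint_estimator n g) - \<theta>, snd (joint_estimator n g) - \<beta>)) \<le> B"
        by (simp add: \<theta>'_def \<beta>'_def)
    qed
    also have "C / K < \<epsilon>" using C \<epsilon> by (simp add: K_def)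
    finally show ?thesis .
  qed
  then show "\<exists>B n\<^sub>0. \<forall>n\<ge>n\<^sub>0. measure_pmf.prob (two_star \<theta> \<beta> n)
      {g. norm (sqrt (real n) *\<^sub>R (fst (joint_estimator n g) - \<theta>, snd (joint_estimator n g) - \<beta>)) > B} < \<epsilon>"
    by blast
qed

theorem corollary1p1:
  shows "(\<exists>\<theta>hat \<beta>hat :: nat \<Rightarrow> adjacency \<Rightarrow> real. \<forall>\<theta>>0. \<forall>\<beta>.
            bounded_in_prob (two_star \<theta> \<beta>)
              (\<lambda>n G. sqrt (real n) *\<^sub>R (\<theta>hat n G - \<theta>, \<beta>hat n G - \<beta>)))
       \<and> (\<forall>\<theta>>0. \<exists>\<beta>hat :: nat \<Rightarrow> adjacency \<Rightarrow> real. \<forall>\<beta>.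
            bounded_in_prob (two_star \<theta> \<beta>)
              (\<lambda>n G. real n * (\<beta>hat n G - \<beta>)))"
proof (intro conjI allI impI)
  show "\<exists>\<theta>hat \<beta>hat :: nat \<Rightarrow> adjacency \<Rightarrow> real. \<forall>\<theta>>0. \<forall>\<beta>.
            bounded_in_prob (two_star \<theta> \<beta>)
              (\<lambda>n G. sqrt (real n) *\<^sub>R (\<theta>hat n G - \<theta>, \<beta>hat n G - \<beta>))"
    using joint_estimator_bounded
    by (intro exI[of _ "\<lambda>n g. fst (joint_estimator n g)"] exI[of _ "\<lambda>n g. snd (joint_estimator n g)"]) simp
  show "\<exists>\<beta>hat :: nat \<Rightarrow> adjacency \<Rightarrow> real. \<forall>\<beta>.
            bounded_in_prob (two_star \<theta> \<beta>) (\<lambda>n G. real n * (\<beta>hat n G - \<beta>))" if "\<theta> > 0" for \<theta>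
    using beta_estimator_bounded[OF that] by blast
qed

end
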